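(* In the setting described in the context: (1) If the model is data uniformly relevant (DUR), the parametrisation $\mathcal P_1=(\tilde X,\Theta)$ is geometrically tight in parameter (GTIP), and $\mathcal L(Z_2)$ has a finite moment generating function in a neighbourhood of $0$, then $\mathcal P_0=(X,\Theta)$ is geometrically ergodic. (2) If the model is parameter uniformly relevant (PUR), $\mathcal P_0$ is GTIP, and $\mathcal L(Z_1)$ has a finite moment generating function in a neighbourhood of $0$, then $\mathcal P_1$ is geometrically ergodic.
   Context: Fix an observed value $y\in\mathbb R$. Consider the model $Y=X+Z_1$, $X=\Theta+Z_2$, where $Z_1,Z_2$ are independent real random variables, independent of $\Theta$, whose distributions are symmetric about $0$ and have continuous, bounded, everywhere positive Lebesgue densities $f_1,f_2$; $\Theta$ is given the improper flat (Lebesgue) prior on $\mathbb R$, and the posterior $\mathcal L(X,\Theta\mid Y=y)$ is proper. Write $\tilde X=X-\Theta$. For a parametrisation $\mathcal P=(U,\Theta)$ with $U\in\{X,\tilde X\}$, the Gibbs sampler started at $\Theta_0$ iterates, for $n\ge1$: draw $U_n\sim\mathcal L(U\mid Y=y,\Theta=\Theta_{n-1})$, then $\Theta_n\sim\mathcal L(\Theta\mid Y=y,U=U_n)$. The centred parametrisation is $\mathcal P_0=(X,\Theta)$ and the non-centred one is $\mathcal P_1=(\tilde X,\Theta)$. A parametrisation is called geometrically ergodic if its marginal chain $\{\Theta_n\}$ satisfies $\|\mathcal L(\Theta_n\mid Y=y,\Theta_0)-\mathcal L(\Theta\mid Y=y)\|_{TV}\le M(\Theta_0)r^n$ for all $n$,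 for some $r<1$ and some function $M$. A parametrisation $(U,\Theta)$ is GTIP (geometrically tight in parameter) if there are constants $a,b>0$ not depending on $\theta$ such that $\mathbf P(|U|>x\mid Y=y,\Theta=\theta)\le ae^{-bx}$ for all $\theta\in\mathbb R$ and $x\ge0$. The model is DUR (data uniformly relevant) if there are $d,k>0$ such that $|\mathbf E\{X\mid Y=y,\Theta=\theta\}|\le|\theta|-d$ for all $|\theta|>k$; it is PUR (parameter uniformly relevant) if there are $d,k>0$ such that $\operatorname{sgn}(\theta)\,\mathbf E\{X-y\mid Y=y,\Theta=\theta\}\ge d$ for all $|\theta|>k$. *)

theory Defs
  imports "HOL-Probability.Probability"
begin

definition noise_density :: "(real \<Rightarrow> real) \<Rightarrow> bool" where
  "noise_density f \<longleftrightarrow> continuous_on UNIV f \<and> bounded (range f) \<and>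
     (\<forall>z. 0 < f z) \<and> (\<forall>z. f (- z) = f z) \<and>
     integrable lborel f \<and> integral\<^sup>L lborel f = 1"

definition ndens :: "(real \<Rightarrow> real) \<Rightarrow> real measure" where
  "ndens g = density lborel (\<lambda>t. ennreal (g t / (\<integral>s. g s \<partial>lborel)))"

text \<open>Unnormalised joint posterior density of (U, Theta) given Y = y
  (flat prior on Theta), for the centred parametrisation U = X ...\<close>
definition joint0 :: "real \<Rightarrow> (real \<Rightarrow> real) \<Rightarrow> (real \<Rightarrow> real) \<Rightarrow> real \<Rightarrow> real \<Rightarrow> real" where
  "joint0 y f1 f2 = (\<lambda>x \<theta>. f1 (y - x) * f2 (x - \<theta>))"

text \<open>... and for the non-centred parametrisation U = X - Theta (Jacobian 1).\<close>
definition joint1 :: "real \<Rightarrow> (real \<Rightarrow> real) \<Rightarrow> (real \<Rightarrow> real) \<Rightarrow> real \<Rightarrow> real \<Rightarrow> real" where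
  "joint1 y f1 f2 = (\<lambda>u \<theta>. f1 (y - (u + \<theta>)) * f2 u)"

definition cond_U :: "(real \<Rightarrow> real \<Rightarrow> real) \<Rightarrow> real \<Rightarrow> real measure" where
  "cond_U j \<theta> = ndens (\<lambda>u. j u \<theta>)"

definition cond_Theta :: "(real \<Rightarrow> real \<Rightarrow> real) \<Rightarrow> real \<Rightarrow> real measure" where
  "cond_Theta j u = ndens (\<lambda>\<theta>. j u \<theta>)"

definition gibbs_kernel :: "(real \<Rightarrow> real \<Rightarrow> real) \<Rightarrow> real \<Rightarrow> real measure" where
  "gibbs_kernel j \<theta> = cond_U j \<theta> \<bind> cond_Theta j"

definition theta_chain :: "(real \<Rightarrow> real \<Rightarrow> real) \<Rightarrow> real \<Rightarrow> nat \<Rightarrow> real measure" where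
  "theta_chain j \<theta>0 n = ((\<lambda>M. M \<bind> gibbs_kernel j) ^^ n) (return borel \<theta>0)"

definition post_theta :: "(real \<Rightarrow> real \<Rightarrow> real) \<Rightarrow> real measure" where
  "post_theta j = ndens (\<lambda>\<theta>. \<integral>u. j u \<theta> \<partial>lborel)"

definition tv_dist :: "real measure \<Rightarrow> real measure \<Rightarrow> real" where
  "tv_dist M N = (SUP A\<in>sets borel. \<bar>measure M A - measure N A\<bar>)"

definition geom_ergodic :: "(real \<Rightarrow> real \<Rightarrow> real) \<Rightarrow> bool" where
  "geom_ergodic j \<longleftrightarrow> (\<exists>r::real. 0 \<le> r \<and> r < 1 \<and> (\<exists>M::real \<Rightarrow> real.
      \<forall>\<theta>0 n. tv_dist (theta_chain j \<theta>0 n) (post_theta j) \<le> M \<theta>0 * r ^ n))"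

definition GTIP :: "(real \<Rightarrow> real \<Rightarrow> real) \<Rightarrow> bool" where
  "GTIP j \<longleftrightarrow> (\<exists>a b::real. 0 < a \<and> 0 < b \<and>
      (\<forall>\<theta> x. 0 \<le> x \<longrightarrow> measure (cond_U j \<theta>) {u. \<bar>u\<bar> > x} \<le> a * exp (- b * x)))"

definition DUR :: "real \<Rightarrow> (real \<Rightarrow> real) \<Rightarrow> (real \<Rightarrow> real) \<Rightarrow> bool" where
  "DUR y f1 f2 \<longleftrightarrow> (\<exists>d k::real. 0 < d \<and> 0 < k \<and> (\<forall>\<theta>. \<bar>\<theta>\<bar> > k \<longrightarrow>
      integrable (cond_U (joint0 y f1 f2) \<theta>) (\<lambda>x. x) \<and>
      \<bar>\<integral>x. x \<partial>cond_U (joint0 y f1 f2) \<theta>\<bar> \<le> \<bar>\<theta>\<bar> - d))"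

definition PUR :: "real \<Rightarrow> (real \<Rightarrow> real) \<Rightarrow> (real \<Rightarrow> real) \<Rightarrow> bool" where
  "PUR y f1 f2 \<longleftrightarrow> (\<exists>d k::real. 0 < d \<and> 0 < k \<and> (\<forall>\<theta>. \<bar>\<theta>\<bar> > k \<longrightarrow>
      integrable (cond_U (joint0 y f1 f2) \<theta>) (\<lambda>x. x - y) \<and>
      sgn \<theta> * (\<integral>x. x - y \<partial>cond_U (joint0 y f1 f2) \<theta>) \<ge> d))"

definition mgf_finite_near0 :: "(real \<Rightarrow> real) \<Rightarrow> bool" where
  "mgf_finite_near0 f \<longleftrightarrow> (\<exists>\<delta>>0. \<forall>t. \<bar>t\<bar> < \<delta> \<longrightarrow>
      integrable lborel (\<lambda>z. exp (t * z) * f z))"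

end

(*
Both Gibbs samplers have the shape j(u, theta) = g(u) h(u - T theta) with T theta = +-theta + const and
h symmetric: T = id, g = f1(y - .), h = f2 in the centred case, and T theta = y - theta, g = f2, h = f1 in
the non-centred one. In both cases GTIP of the other parametrisation says that U - T theta has
exponential moments uniformly in theta, and DUR/PUR says that its mean points towards 0 from both
sides, by at least d, when |T theta| is large. Expanding to second order in s, the Lyapunov function
cosh(s T theta) then satisfies a geometric drift condition for small s > 0. Since T theta' = U - Z with
Z symmetric and independent of U, this last half-step only multiplies the expected value by
E cosh(s Z) = 1 + O(s^2). Level sets are small because the densities are bounded below on compacts.
Harris' theorem follows from the Hairer-Mattingly argument: the kernel contracts the seminorm
sup |phi x - phi y| / (2 + beta V x + beta V y).
*)
theory Submission
  imports Defs
begin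

section \<open>Harris theorem\<close>

text \<open>The invariant law is explicit: it is the marginal posterior, and its invariance is a
  Tonelli computation. What the convergence proof must still supply is that the unbounded
  \<open>V\<close> is integrable under it; this cannot be read off by integrating the drift
  inequality, whose two sides might both be infinite.

  GTIP of the opposite parametrisation is the right hypothesis because the deviation
  \<open>U - T \<theta>\<close> is the other latent variable: X - \<theta> in the centred case, and
  (X - \<theta>) - (y - \<theta>) = X - y in the non-centred one.

  Cosh is used rather than exp of an absolute value because its addition formula separates the
  current state from the increment: the noise half-step becomes exact (the sinh term is odd and
  integrates to 0), and in the other half-step the mean of the increment appears as the coefficient
  of sinh. That first-order gain, of size s*d, has to beat every loss of order s^2, including the
  noise factor. One s must work for all \<theta>, so the second-order constants must not depend on
  \<theta>; this is where uniform geometric tightness enters, as opposed to an exponential moment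
  for each \<theta> separately.\<close>

locale drift_kernel =
  fixes M :: "'a measure" and K :: "'a \<Rightarrow> 'a measure" and V :: "'a \<Rightarrow> real" and lam L :: real
  assumes kernel: "K \<in> M \<rightarrow>\<^sub>M prob_algebra M"
    and V_measurable [measurable]: "V \<in> borel_measurable M"
    and V_nonneg: "\<And>x. x \<in> space M \<Longrightarrow> 0 \<le> V x"
    and lam_nonneg: "0 \<le> lam" and lam_less_1: "lam < 1" and L_pos: "0 < L"
    and drift: "\<And>x. x \<in> space M \<Longrightarrow> (\<integral>\<^sup>+z. ennreal (V z) \<partial>K x) \<le> ennreal (lam * V x + L)"
begin

lemma kernel_subprob [measurable]: "K \<in> M \<rightarrow>\<^sub>M subprob_algebra M"
  using kernel by (rule measurable_prob_algebraD)

lemma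
  assumes "x \<in> space M"
  shows sets_kernel_eq: "sets (K x) = sets M" and prob_space_kernel: "prob_space (K x)"
  using measurable_space[OF kernel assms] by (auto simp: space_prob_algebra)

lemma space_kernel_eq: "x \<in> space M \<Longrightarrow> space (K x) = space M"
  by (intro sets_eq_imp_space_eq sets_kernel_eq)

lemma
  assumes x: "x \<in> space M"
  shows integrable_V: "integrable (K x) V" and integral_V_le: "(\<integral>z. V z \<partial>K x) \<le> lam * V x + L"
proof -
  have [measurable]: "V \<in> borel_measurable (K x)"
    using V_measurable sets_kernel_eq[OF x] by (simp cong: measurable_cong_sets)
  have AE: "AE z in K x. 0 \<le> V z"
    by (rule AE_I2) (simp add: space_kernel_eq[OF x] V_nonneg)
  have 0: "0 \<le> lam * V x + L"
    using V_nonneg[OF x] lam_nonneg L_pos by simp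
  show *: "integrable (K x) V"
    using drift[OF x] AE by (intro integrableI_nonneg) (auto simp: less_top[symmetric] top_unique)
  show "(\<integral>z. V z \<partial>K x) \<le> lam * V x + L"
    using drift[OF x] nn_integral_eq_integral[OF * AE] 0 by simp
qed

section \<open>Duality between measures and bounded test functions\<close>

definition Pop :: "('a \<Rightarrow> real) \<Rightarrow> 'a \<Rightarrow> real" where
  "Pop \<phi> x = (\<integral>z. \<phi> z \<partial>K x)"

text \<open>A class closed under \<open>Pop\<close> and integrable against every probability measure
  on \<open>M\<close>, so the iteration raises no integrability questions. It contains all
  indicators, which suffices for total variation.\<close>

definition bdd_fun :: "('a \<Rightarrow> real) \<Rightarrow> bool" where
  "bdd_fun \<phi> \<longleftrightarrow> \<phi> \<in> borel_measurable M \<and> (\<exists>B. \<forall>x\<in>space M. \<bar>\<phi> x\<bar> \<le> B)"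

lemma bdd_fun_integrable:
  assumes "bdd_fun \<phi>" "finite_measure N" "sets N = sets M"
  shows "integrable N \<phi>"
proof -
  interpret finite_measure N by fact
  obtain B where "\<And>x. x \<in> space M \<Longrightarrow> \<bar>\<phi> x\<bar> \<le> B"
    using assms by (auto simp: bdd_fun_def)
  then show ?thesis
    using assms sets_eq_imp_space_eq[OF assms(3)]
    by (intro integrable_const_bound[where B = B]) (auto simp: bdd_fun_def cong: measurable_cong_sets)
qed

lemma bdd_fun_integrable_kernel:
  assumes "bdd_fun \<phi>" "x \<in> space M"
  shows "integrable (K x) \<phi>"
proof -
  interpret prob_space "K x" using assms(2) by (rule prob_space_kernel)
  show ?thesis
    using assms by (intro bdd_fun_integrable) (auto simp: sets_kernel_eq finite_measure_axioms)
qed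

lemma bdd_fun_Pop:
  assumes "bdd_fun \<phi>"
  shows "bdd_fun (Pop \<phi>)"
proof -
  have m: "\<phi> \<in> borel_measurable M"
    using assms by (simp add: bdd_fun_def)
  obtain B where B: "\<And>x. x \<in> space M \<Longrightarrow> \<bar>\<phi> x\<bar> \<le> B"
    using assms by (auto simp: bdd_fun_def)
  have "Pop \<phi> \<in> borel_measurable M"
    unfolding Pop_def[abs_def]
    by (rule measurable_compose[OF kernel_subprob integral_measurable_subprob_algebra[OF m]])
  moreover have "\<bar>Pop \<phi> x\<bar> \<le> B" if x: "x \<in> space M" for x
  proof -
    interpret prob_space "K x" using x by (rule prob_space_kernel)
    have "\<bar>Pop \<phi> x\<bar> \<le> (\<integral>z. \<bar>\<phi> z\<bar> \<partial>K x)"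
      unfolding Pop_def by (rule integral_abs_bound)
    also have "\<dots> \<le> B"
      using bdd_fun_integrable_kernel[OF assms x] B
      by (intro integral_le_const) (auto simp: space_kernel_eq[OF x])
    finally show ?thesis .
  qed
  ultimately show ?thesis by (auto simp: bdd_fun_def)
qed

lemma bdd_fun_Pop_pow: "bdd_fun \<phi> \<Longrightarrow> bdd_fun ((Pop ^^ n) \<phi>)"
  by (induction n) (auto intro: bdd_fun_Pop)

lemma
  assumes N: "prob_space N" "sets N = sets M"
  shows sets_bind_kernel: "sets (N \<bind> K) = sets M"
    and prob_space_bind_kernel: "prob_space (N \<bind> K)"
    and integral_bind_kernel: "bdd_fun \<phi> \<Longrightarrow> (\<integral>x. \<phi> x \<partial>(N \<bind> K)) = (\<integral>x. Pop \<phi> x \<partial>N)"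
proof -
  interpret N: prob_space N by fact
  have [measurable]: "K \<in> N \<rightarrow>\<^sub>M subprob_algebra M"
    using kernel_subprob N(2) by (simp cong: measurable_cong_sets)
  have sp: "space N = space M" using N(2) by (rule sets_eq_imp_space_eq)
  have *: "AE x in N. prob_space (K x)"
    using prob_space_kernel by (intro AE_I2) (simp add: sp)
  show "sets (N \<bind> K) = sets M"
    using sets_kernel_eq N.not_empty by (intro sets_bind) (auto simp: sp)
  show "prob_space (N \<bind> K)"
    using * by (rule N.prob_space_bind) measurable
  assume \<phi>: "bdd_fun \<phi>"
  then obtain B where B: "\<And>x. x \<in> space M \<Longrightarrow> \<bar>\<phi> x\<bar> \<le> B"
    by (auto simp: bdd_fun_def)
  have m: "\<phi> \<in> borel_measurable M"
    using \<phi> by (simp add: bdd_fun_def)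
  show "(\<integral>x. \<phi> x \<partial>(N \<bind> K)) = (\<integral>x. Pop \<phi> x \<partial>N)"
    unfolding Pop_def
  proof (rule integral_bind[where K = M and B = B and B' = 1])
    show "AE x in N. emeasure (K x) (space (K x)) \<le> ennreal 1"
      using * by eventually_elim (simp add: prob_space.emeasure_space_1)
  qed (use m B N.finite_measure_axioms in auto)
qed

lemma
  assumes N: "prob_space N" "sets N = sets M"
  shows prob_space_bind_kernel_pow: "prob_space (((\<lambda>N. N \<bind> K) ^^ n) N)"
    and sets_bind_kernel_pow: "sets (((\<lambda>N. N \<bind> K) ^^ n) N) = sets M"
  by (induction n) (use N in \<open>auto simp: sets_bind_kernel prob_space_bind_kernel\<close>)

lemma integral_bind_kernel_pow:
  assumes N: "prob_space N" "sets N = sets M" and \<phi>: "bdd_fun \<phi>"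
  shows "(\<integral>x. \<phi> x \<partial>((\<lambda>N. N \<bind> K) ^^ n) N) = (\<integral>x. (Pop ^^ n) \<phi> x \<partial>N)"
  using \<phi>
proof (induction n arbitrary: \<phi>)
  case (Suc n)
  have "(\<integral>x. \<phi> x \<partial>((\<lambda>N. N \<bind> K) ^^ Suc n) N) = (\<integral>x. Pop \<phi> x \<partial>((\<lambda>N. N \<bind> K) ^^ n) N)"
    using integral_bind_kernel[OF prob_space_bind_kernel_pow[OF N] sets_bind_kernel_pow[OF N] Suc.prems]
    by simp
  also have "\<dots> = (\<integral>x. (Pop ^^ n) (Pop \<phi>) x \<partial>N)"
    by (intro Suc.IH bdd_fun_Pop Suc.prems)
  finally show ?case by (simp add: funpow_swap1)
qed simp

lemma measure_bind_kernel_pow: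
  assumes N: "prob_space N" "sets N = sets M" and A: "A \<in> sets M"
  shows "measure (((\<lambda>N. N \<bind> K) ^^ n) N) A = (\<integral>x. (Pop ^^ n) (indicator A) x \<partial>N)"
proof -
  have "bdd_fun (indicator A)"
    using A by (auto simp: bdd_fun_def intro!: exI[of _ 1] split: split_indicator)
  from integral_bind_kernel_pow[OF N this, of n] show ?thesis
    using sets.sets_into_space[OF A]
    by (simp add: sets_eq_imp_space_eq[OF sets_bind_kernel_pow[OF N]] Int_absorb2)
qed

text \<open>Invariance and drift suggest that the integral of \<open>V\<close> is at most
  \<open>lam\<close> times itself plus \<open>L\<close>, but solving for it presupposes finiteness.
  Hence truncation at level \<open>m\<close>, a bound uniform in \<open>m\<close>, and
  Fatou.\<close>

lemma invariant_integral_V: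
  assumes pi: "prob_space \<pi>" "sets \<pi> = sets M" and inv: "\<pi> \<bind> K = \<pi>"
  shows "integrable \<pi> V" and "(\<integral>x. V x \<partial>\<pi>) \<le> L / (1 - lam)"
proof -
  interpret pi: prob_space \<pi> by fact
  have sp: "space \<pi> = space M" using pi(2) by (rule sets_eq_imp_space_eq)
  have Vm [measurable]: "V \<in> borel_measurable \<pi>"
    using V_measurable pi(2) by (simp cong: measurable_cong_sets)
  have lim: "(\<integral>x. (if V x \<le> m then V x else 0) \<partial>\<pi>) \<le> L / (1 - lam)" if m: "0 \<le> m" for m :: real
  proof -
    \<comment> \<open>Compare the two sides of the invariance identity for the truncation \<open>min V m\<close>:
      the contributions of \<open>V > m\<close> cancel.\<close>
    let ?\<phi> = "\<lambda>x. min (V x) m"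
    have \<phi>: "bdd_fun ?\<phi>"
      using m V_nonneg by (auto simp: bdd_fun_def intro!: exI[of _ m])
    \<comment> \<open>Majorant of \<open>Pop\<close> of the truncation: the drift bound below the
      level, the trivial bound \<open>m\<close> above it.\<close>
    let ?g = "\<lambda>x. if V x \<le> m then lam * V x + L else m"
    let ?h = "\<lambda>x. if V x \<le> m then V x else 0"
    have int_h: "integrable \<pi> ?h"
      using V_nonneg m by (intro pi.integrable_const_bound[where B = m]) (auto simp: sp)
    have int_g: "integrable \<pi> ?g"
    proof (rule pi.integrable_const_bound[where B = "lam * m + L + m"])
      have "\<bar>?g x\<bar> \<le> lam * m + L + m" if "x \<in> space M" for x
      proof -
        have "0 \<le> lam * V x" "0 \<le> lam * m" "V x \<le> m \<Longrightarrow> lam * V x \<le> lam * m"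
          using V_nonneg[OF that] lam_nonneg m by (auto intro: mult_left_mono)
        then show ?thesis using L_pos m by auto
      qed
      then show "AE x in \<pi>. norm (?g x) \<le> lam * m + L + m"
        by (intro AE_I2) (auto simp: sp)
    qed simp
    have P: "Pop ?\<phi> x \<le> ?g x" if x: "x \<in> space M" for x
    proof -
      interpret Kx: prob_space "K x" using x by (rule prob_space_kernel)
      have i: "integrable (K x) ?\<phi>" by (rule bdd_fun_integrable_kernel[OF \<phi> x])
      have "Pop ?\<phi> x \<le> (\<integral>z. V z \<partial>K x)"
        unfolding Pop_def by (rule integral_mono[OF i integrable_V[OF x]]) simp
      moreover have "Pop ?\<phi> x \<le> m"
        unfolding Pop_def using i by (rule Kx.integral_le_const) simp
      ultimately show ?thesis using integral_V_le[OF x] by simp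
    qed
    have "(\<integral>x. ?\<phi> x \<partial>\<pi>) = (\<integral>x. Pop ?\<phi> x \<partial>\<pi>)"
      using integral_bind_kernel[OF pi \<phi>] inv by simp
    also have "\<dots> \<le> (\<integral>x. ?g x \<partial>\<pi>)"
      using bdd_fun_integrable[OF bdd_fun_Pop[OF \<phi>] pi.finite_measure_axioms pi(2)] P
      by (intro integral_mono int_g) (auto simp: sp)
    finally have "0 \<le> (\<integral>x. ?g x - ?\<phi> x \<partial>\<pi>)"
      using int_g bdd_fun_integrable[OF \<phi> pi.finite_measure_axioms pi(2)] by simp
    also have "\<dots> \<le> (\<integral>x. L - (1 - lam) * ?h x \<partial>\<pi>)"
      using int_g bdd_fun_integrable[OF \<phi> pi.finite_measure_axioms pi(2)] int_h L_pos
      by (intro integral_mono) (auto simp: algebra_simps)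
    also have "\<dots> = L - (1 - lam) * (\<integral>x. ?h x \<partial>\<pi>)"
      using int_h by (simp add: pi.prob_space)
    finally show ?thesis using lam_less_1 by (simp add: field_simps)
  qed
  let ?F = "\<lambda>m::nat. \<lambda>x. if V x \<le> real m then V x else 0"
  have int: "integrable \<pi> (?F m)" for m
    using V_nonneg by (intro pi.integrable_const_bound[where B = "real m"]) (auto simp: sp)
  \<comment> \<open>For fixed \<open>x\<close> the truncations equal \<open>V x\<close> from
    \<open>m\<close> = ceiling of \<open>V x\<close> on, so their liminf is
    \<open>V x\<close>.\<close>
  have "(\<integral>\<^sup>+x. V x \<partial>\<pi>) = (\<integral>\<^sup>+x. liminf (\<lambda>m. ennreal (?F m x)) \<partial>\<pi>)"
  proof (rule nn_integral_cong)
    fix x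
    have "eventually (\<lambda>m. ennreal (V x) = ennreal (?F m x)) sequentially"
      using eventually_ge_at_top[of "nat \<lceil>V x\<rceil>"] by eventually_elim (simp add: nat_ceiling_le_eq)
    then have "(\<lambda>m. ennreal (?F m x)) \<longlonglongrightarrow> ennreal (V x)"
      using tendsto_cong by force
    then show "ennreal (V x) = liminf (\<lambda>m. ennreal (?F m x))"
      using lim_imp_Liminf by force
  qed
  also have "\<dots> \<le> liminf (\<lambda>m. \<integral>\<^sup>+x. ennreal (?F m x) \<partial>\<pi>)"
    by (rule nn_integral_liminf) measurable
  also have "\<dots> \<le> ennreal (L / (1 - lam))"
  proof (rule Liminf_le)
    have "(\<integral>\<^sup>+x. ennreal (?F m x) \<partial>\<pi>) \<le> ennreal (L / (1 - lam))" for m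
      using lim[of "real m"] V_nonneg
      by (subst nn_integral_eq_integral[OF int]) (auto simp: sp intro!: ennreal_leI)
    then show "\<forall>\<^sub>F m in sequentially. (\<integral>\<^sup>+x. ennreal (?F m x) \<partial>\<pi>) \<le> ennreal (L / (1 - lam))"
      by simp
  qed simp
  finally have le: "(\<integral>\<^sup>+x. V x \<partial>\<pi>) \<le> ennreal (L / (1 - lam))" .
  have AE: "AE x in \<pi>. 0 \<le> V x"
    by (rule AE_I2) (simp add: sp V_nonneg)
  show i: "integrable \<pi> V"
    using le AE by (intro integrableI_nonneg) (auto simp: less_top[symmetric] top_unique)
  have "0 \<le> L / (1 - lam)" using L_pos lam_less_1 by simp
  then show "(\<integral>x. V x \<partial>\<pi>) \<le> L / (1 - lam)"
    using le nn_integral_eq_integral[OF i AE] by simp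
qed

end

text \<open>The level 4L/(1 - lam) serves two purposes. If \<open>V x + V y\<close> is below it,
  both points lie in the small set; if the sum is above it, the additive constant 2L of the summed
  drift is at most half of the decrease (1 - lam)(V x + V y).\<close>

locale harris_kernel = drift_kernel +
  fixes \<nu> :: "'a measure" and eps :: real
  assumes nu_prob: "prob_space \<nu>" and nu_sets: "sets \<nu> = sets M" and eps_pos: "0 < eps"
    and minor: "\<And>x A. x \<in> space M \<Longrightarrow> V x \<le> 4 * L / (1 - lam) \<Longrightarrow> A \<in> sets M \<Longrightarrow>
      ennreal eps * emeasure \<nu> A \<le> emeasure (K x) A"
begin

text \<open>Extends the minorization from sets to nonnegative functions. Integrability under
  \<open>\<nu>\<close> is inherited from \<open>K x\<close>; this is how the weight, which contains
  \<open>V\<close>, becomes integrable under \<open>\<nu>\<close>.\<close>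

lemma
  assumes x: "x \<in> space M" "V x \<le> 4 * L / (1 - lam)"
    and f: "integrable (K x) f" "\<And>z. z \<in> space M \<Longrightarrow> 0 \<le> f z"
  shows minor_integrable: "integrable \<nu> f"
    and minor_integral: "eps * (\<integral>z. f z \<partial>\<nu>) \<le> (\<integral>z. f z \<partial>K x)"
proof -
  have sp: "space \<nu> = space M" using nu_sets by (rule sets_eq_imp_space_eq)
  have m: "f \<in> borel_measurable \<nu>"
    using borel_measurable_integrable[OF f(1)] sets_kernel_eq[OF x(1)] nu_sets
    by (simp cong: measurable_cong_sets)
  have s: "sets (scale_measure (ennreal eps) \<nu>) = sets (K x)"
    using sets_kernel_eq[OF x(1)] nu_sets by simp
  \<comment> \<open>The order on measures with equal sigma-algebras compares all sets; on
    non-measurable ones both sides are 0.\<close>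
  have "scale_measure (ennreal eps) \<nu> \<le> K x"
    unfolding le_measure_iff
    using s sets_eq_imp_space_eq[OF s] minor[OF x] sets_kernel_eq[OF x(1)]
    by (auto simp: le_fun_def) (metis emeasure_notin_sets nu_sets mult_zero_right order_refl)
  from nn_integral_mono_measure[OF s this, of f]
  have le: "ennreal eps * (\<integral>\<^sup>+z. f z \<partial>\<nu>) \<le> (\<integral>\<^sup>+z. f z \<partial>K x)"
    using m by (simp add: nn_integral_scale_measure)
  have AE: "AE z in K x. 0 \<le> f z" "AE z in \<nu>. 0 \<le> f z"
    using f(2) by (auto intro!: AE_I2 simp: sp space_kernel_eq[OF x(1)])
  have le: "ennreal eps * (\<integral>\<^sup>+z. f z \<partial>\<nu>) \<le> ennreal (\<integral>z. f z \<partial>K x)"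
    using le nn_integral_eq_integral[OF f(1) AE(1)] by simp
  then have "(\<integral>\<^sup>+z. f z \<partial>\<nu>) < \<infinity>"
    using eps_pos by (auto simp: less_top[symmetric] top_unique ennreal_mult_top)
  then show i: "integrable \<nu> f"
    using m AE by (intro integrableI_nonneg) auto
  have "0 \<le> (\<integral>z. f z \<partial>K x)" "0 \<le> (\<integral>z. f z \<partial>\<nu>)"
    using AE by (auto intro: integral_nonneg_AE)
  then show "eps * (\<integral>z. f z \<partial>\<nu>) \<le> (\<integral>z. f z \<partial>K x)"
    using le eps_pos unfolding nn_integral_eq_integral[OF i AE(2)]
    by (simp add: ennreal_mult[symmetric])
qed

text \<open>With \<open>beta * L = eps / 2\<close> the additive drift constant uses up only half of the gain from the
  minorization; \<open>rate\<close> is then a contraction factor both on the small set and away from it.\<close>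

definition beta :: real where "beta = eps / (2 * L)"

definition rate :: real where "rate = 1 - eps * (1 - lam) / (2 * (1 - lam + eps))"

lemma beta_pos: "0 < beta"
  using eps_pos L_pos by (simp add: beta_def)

text \<open>The reciprocal of 1 - rate is 2/(1 - lam) + 2/eps, so 1 - rate is at most half of 1 -
  lam and half of eps. Nonnegativity follows from that of \<open>lam\<close>.\<close>

lemma
  shows rate_ge: "lam \<le> rate" and rate_ge': "1 - eps / 2 \<le> rate"
    and rate_nonneg: "0 \<le> rate" and rate_less_1: "rate < 1"
proof -
  have p: "0 < 1 - lam + eps" "0 < 1 - lam" using eps_pos lam_less_1 by auto
  have 1: "eps * (1 - lam) / (2 * (1 - lam + eps)) \<le> 1 - lam"
  proof -
    have "eps / (2 * (1 - lam + eps)) \<le> 1" using p eps_pos by simp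
    from mult_right_mono[OF this, of "1 - lam"] show ?thesis using p by simp
  qed
  have 2: "eps * (1 - lam) / (2 * (1 - lam + eps)) \<le> eps / 2"
    using p eps_pos by (simp add: field_simps)
  have 3: "eps * (1 - lam) / (2 * (1 - lam + eps)) > 0"
    using p eps_pos by simp
  show "lam \<le> rate" "1 - eps / 2 \<le> rate" "rate < 1" using 1 2 3 by (auto simp: rate_def)
  then show "0 \<le> rate" using lam_nonneg by simp
qed

text \<open>Here \<open>s\<close> stands for \<open>V x + V y\<close>. By the choice of
  \<open>beta\<close>, each half of the gain (1 - lam)*beta*s is at least eps: one half pays for the
  additive term 2*beta*L = eps, the other for (1 - rate)(2 + beta*s).\<close>

lemma rate_large:
  assumes "4 * L / (1 - lam) \<le> s"
  shows "2 + beta * (lam * s + 2 * L) \<le> rate * (2 + beta * s)"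
proof -
  define p where "p = 1 - lam"
  have p: "0 < p" "0 < p + eps" using eps_pos lam_less_1 by (auto simp: p_def)
  have s: "4 * L \<le> p * s"
    using assms p by (simp add: field_simps p_def)
  have b: "beta * L = eps / 2" using L_pos by (simp add: beta_def)
  have "2 * eps \<le> p * (beta * s)"
  proof -
    have "4 * (beta * L) \<le> p * (beta * s)"
      using mult_left_mono[OF s, of beta] beta_pos by (simp add: ac_simps)
    then show ?thesis using b by simp
  qed
  then have "eps * p * (2 + beta * s) \<le> (p + eps) * (p * (beta * s))"
    using mult_left_mono[of "2 * eps" "p * (beta * s)" p] p by (simp add: algebra_simps)
  moreover have "eps * p * (2 + beta * s) / (2 * (p + eps)) \<le> p * (beta * s) / 2
     \<longleftrightarrow> eps * p * (2 + beta * s) \<le> (p + eps) * (p * (beta * s))"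
    using p by (simp add: field_simps)
  moreover have "p * (beta * s) / 2 \<le> p * (beta * s) - eps"
    using \<open>2 * eps \<le> p * (beta * s)\<close> by linarith
  ultimately have "eps * p * (2 + beta * s) / (2 * (p + eps)) \<le> p * (beta * s) - eps"
    by linarith
  then have "2 + beta * s - (p * (beta * s) - eps) \<le> rate * (2 + beta * s)"
    by (simp add: rate_def p_def[symmetric] left_diff_distrib)
  then show ?thesis using b by (simp add: p_def algebra_simps)
qed

text \<open>With \<open>\<phi> - c\<close> between -W and W, the difference
  \<open>Pop \<phi> x - Pop \<phi> y\<close> is the sum of the integrals of \<open>W\<close> under
  \<open>K x\<close> and \<open>K y\<close>, minus the integrals of the two nonnegative slacks
  \<open>W - \<phi> + c\<close> and \<open>W + \<phi> - c\<close>. For large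
  \<open>V x + V y\<close> the slacks are dropped and drift alone contracts. Otherwise each slack is
  at least eps times its \<open>\<nu>\<close>-integral; in their sum \<open>\<phi>\<close> and
  \<open>c\<close> cancel, leaving twice the integral of \<open>W\<close>, which is at least
  2a.\<close>

lemma contraction:
  assumes \<phi>: "bdd_fun \<phi>" and a: "0 \<le> a"
    and osc: "\<And>x y. x \<in> space M \<Longrightarrow> y \<in> space M \<Longrightarrow> \<phi> x - \<phi> y \<le> a * (2 + beta * (V x + V y))"
    and x: "x \<in> space M" and y: "y \<in> space M"
  shows "Pop \<phi> x - Pop \<phi> y \<le> rate * a * (2 + beta * (V x + V y))"
proof -
  interpret Kx: prob_space "K x" using x by (rule prob_space_kernel)
  interpret Ky: prob_space "K y" using y by (rule prob_space_kernel)
  interpret nu: prob_space \<nu> by (rule nu_prob)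
  define W where "W z = a * (1 + beta * V z)" for z
  have W_ge: "a \<le> W z" if "z \<in> space M" for z
    using a beta_pos V_nonneg[OF that] mult_left_mono[of 1 "1 + beta * V z" a] by (simp add: W_def)
  obtain B where B: "\<And>z. z \<in> space M \<Longrightarrow> \<bar>\<phi> z\<bar> \<le> B"
    using \<phi> by (auto simp: bdd_fun_def)
  \<comment> \<open>A function of oscillation at most \<open>W x + W y\<close> is bounded by \<open>W\<close> up to the additive constant \<open>c\<close>.\<close>
  define c where "c = (SUP z\<in>space M. \<phi> z - W z)"
  have "\<phi> z - W z \<le> B" if "z \<in> space M" for z
    using B[OF that] W_ge[OF that] a by linarith
  then have bdd: "bdd_above ((\<lambda>z. \<phi> z - W z) ` space M)" by (rule bdd_aboveI2)
  have c1: "0 \<le> W z - \<phi> z + c" if "z \<in> space M" for z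
    using cSUP_upper[OF that bdd] by (simp add: c_def)
  have c2: "0 \<le> W z + \<phi> z - c" if z: "z \<in> space M" for z
  proof -
    have "c \<le> \<phi> z + W z"
      unfolding c_def
    proof (rule cSUP_least)
      show "space M \<noteq> {}" using x by auto
      fix w assume w: "w \<in> space M"
      show "\<phi> w - W w \<le> \<phi> z + W z"
        using osc[OF w z] by (simp add: W_def algebra_simps)
    qed
    then show ?thesis by simp
  qed
  have iW: "integrable (K z) W" if "z \<in> space M" for z
  proof -
    interpret prob_space "K z" using that by (rule prob_space_kernel)
    show ?thesis unfolding W_def[abs_def] using integrable_V[OF that] by simp
  qed
  have PW: "(\<integral>w. W w \<partial>K z) \<le> a * (1 + beta * (lam * V z + L))" if "z \<in> space M" for z
  proof -
    interpret prob_space "K z" using that by (rule prob_space_kernel)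
    show ?thesis unfolding W_def[abs_def] using integrable_V[OF that] integral_V_le[OF that] a beta_pos
      by (simp add: prob_space mult_left_mono)
  qed
  note i = bdd_fun_integrable_kernel[OF \<phi>]
  have ix: "integrable (K x) (\<lambda>z. W z - \<phi> z + c)" and iy: "integrable (K y) (\<lambda>z. W z + \<phi> z - c)"
    using iW i x y by auto
  have ex: "(\<integral>z. W z - \<phi> z + c \<partial>K x) = (\<integral>z. W z \<partial>K x) - Pop \<phi> x + c"
    using iW[OF x] i[OF x] by (simp add: Pop_def Kx.prob_space)
  have ey: "(\<integral>z. W z + \<phi> z - c \<partial>K y) = (\<integral>z. W z \<partial>K y) + Pop \<phi> y - c"
    using iW[OF y] i[OF y] by (simp add: Pop_def Ky.prob_space)
  show ?thesis
  proof (cases "4 * L / (1 - lam) \<le> V x + V y")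
    case True
    have "0 \<le> (\<integral>z. W z - \<phi> z + c \<partial>K x)" "0 \<le> (\<integral>z. W z + \<phi> z - c \<partial>K y)"
      using c1 c2 by (auto intro!: integral_nonneg_AE AE_I2 simp: space_kernel_eq x y)
    then have "Pop \<phi> x - Pop \<phi> y \<le> a * (2 + beta * (lam * (V x + V y) + 2 * L))"
      using ex ey PW[OF x] PW[OF y] by (simp add: algebra_simps)
    also have "\<dots> \<le> a * (rate * (2 + beta * (V x + V y)))"
      using rate_large[OF True] a by (rule mult_left_mono)
    finally show ?thesis by (simp add: ac_simps)
  next
    case False
    then have Vx: "V x \<le> 4 * L / (1 - lam)" and Vy: "V y \<le> 4 * L / (1 - lam)"
      using V_nonneg[OF x] V_nonneg[OF y] by auto
    have nuW: "integrable \<nu> W"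
      using minor_integrable[OF x Vx iW[OF x]] W_ge a by force
    have nu\<phi>: "integrable \<nu> \<phi>"
      using \<phi> nu.finite_measure_axioms nu_sets by (rule bdd_fun_integrable)
    have mx: "eps * (\<integral>z. W z - \<phi> z + c \<partial>\<nu>) \<le> (\<integral>z. W z - \<phi> z + c \<partial>K x)"
      using minor_integral[OF x Vx ix] c1 by simp
    have my: "eps * (\<integral>z. W z + \<phi> z - c \<partial>\<nu>) \<le> (\<integral>z. W z + \<phi> z - c \<partial>K y)"
      using minor_integral[OF y Vy iy] c2 by simp
    have "(\<integral>z. W z - \<phi> z + c \<partial>\<nu>) + (\<integral>z. W z + \<phi> z - c \<partial>\<nu>) = 2 * (\<integral>z. W z \<partial>\<nu>)"
      using nuW nu\<phi> by (simp add: nu.prob_space)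
    then have "eps * (2 * (\<integral>z. W z \<partial>\<nu>)) \<le> (\<integral>z. W z - \<phi> z + c \<partial>K x) + (\<integral>z. W z + \<phi> z - c \<partial>K y)"
      using add_mono[OF mx my] by (simp add: distrib_left[symmetric])
    moreover have "a \<le> (\<integral>z. W z \<partial>\<nu>)"
      using W_ge nuW by (intro nu.integral_ge_const) (auto simp: sets_eq_imp_space_eq[OF nu_sets])
    then have "eps * (2 * a) \<le> eps * (2 * (\<integral>z. W z \<partial>\<nu>))"
      using eps_pos by simp
    ultimately have "Pop \<phi> x - Pop \<phi> y \<le> (\<integral>w. W w \<partial>K x) + (\<integral>w. W w \<partial>K y) - eps * (2 * a)"
      using ex ey by linarith
    also have "\<dots> \<le> a * (2 - 2 * eps + beta * (lam * (V x + V y)) + 2 * (beta * L))"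
      using PW[OF x] PW[OF y] by (simp add: algebra_simps)
    also have "\<dots> = a * (2 * (1 - eps / 2) + lam * (beta * (V x + V y)))"
      using L_pos by (simp add: beta_def)
    also have "\<dots> \<le> a * (2 * rate + rate * (beta * (V x + V y)))"
      using rate_ge rate_ge' V_nonneg[OF x] V_nonneg[OF y] beta_pos a
      by (intro mult_left_mono add_mono mult_right_mono) auto
    finally show ?thesis by (simp add: algebra_simps)
  qed
qed

text \<open>The induction starts with \<open>a\<close> = 1 because an indicator oscillates by at
  most 1, whatever the set; hence a bound uniform in \<open>A\<close>.\<close>

lemma contraction_pow:
  assumes A: "A \<in> sets M" and x: "x \<in> space M" and y: "y \<in> space M"
  shows "(Pop ^^ n) (indicator A) x - (Pop ^^ n) (indicator A) y \<le> rate ^ n * (2 + beta * (V x + V y))"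
  using x y
proof (induction n arbitrary: x y)
  case 0
  have "0 \<le> beta * (V x + V y)" using V_nonneg 0 beta_pos by simp
  moreover have "indicator A x - indicator A y \<le> (1::real)" by (auto split: split_indicator)
  ultimately show ?case by simp
next
  case (Suc n)
  have "bdd_fun (indicator A)"
    using A by (auto simp: bdd_fun_def intro!: exI[of _ 1] split: split_indicator)
  from contraction[OF bdd_fun_Pop_pow[OF this] _ Suc.IH Suc.prems] show ?case
    using rate_nonneg by simp
qed

text \<open>By invariance, the mass of \<open>A\<close> under \<open>\<pi>\<close> is also the
  \<open>\<pi>\<close>-average of the n-step probabilities of \<open>A\<close>. The two-point
  contraction is therefore averaged over its second argument, and
  \<open>invariant_integral_V\<close> bounds the resulting mean of \<open>V\<close>.\<close>

theorem geometric_ergodicity: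
  assumes pi: "prob_space \<pi>" "sets \<pi> = sets M" and inv: "\<pi> \<bind> K = \<pi>"
    and x: "x \<in> space M" and A: "A \<in> sets M"
  shows "\<bar>measure (((\<lambda>N. N \<bind> K) ^^ n) (return M x)) A - measure \<pi> A\<bar>
    \<le> (2 + beta * (V x + L / (1 - lam))) * rate ^ n"
proof -
  interpret pi: prob_space \<pi> by fact
  let ?\<psi> = "(Pop ^^ n) (indicator A)"
  have b: "bdd_fun ?\<psi>"
    using A by (intro bdd_fun_Pop_pow) (auto simp: bdd_fun_def intro!: exI[of _ 1] split: split_indicator)
  have i: "integrable \<pi> ?\<psi>"
    using b pi.finite_measure_axioms pi(2) by (rule bdd_fun_integrable)
  have iV: "integrable \<pi> V" by (rule invariant_integral_V[OF pi inv])
  have "((\<lambda>N. N \<bind> K) ^^ n) \<pi> = \<pi>" by (induction n) (simp_all add: inv)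
  then have 1: "measure \<pi> A = (\<integral>z. ?\<psi> z \<partial>\<pi>)"
    using measure_bind_kernel_pow[OF pi A, of n] by simp
  have 2: "measure (((\<lambda>N. N \<bind> K) ^^ n) (return M x)) A = ?\<psi> x"
    using measure_bind_kernel_pow[OF prob_space_return[OF x] _ A, of n] b x
    by (simp add: integral_return bdd_fun_def)
  have "\<bar>?\<psi> x - (\<integral>z. ?\<psi> z \<partial>\<pi>)\<bar> = \<bar>\<integral>z. ?\<psi> x - ?\<psi> z \<partial>\<pi>\<bar>"
    using i by (simp add: pi.prob_space)
  also have "\<dots> \<le> (\<integral>z. \<bar>?\<psi> x - ?\<psi> z\<bar> \<partial>\<pi>)"
    by (rule integral_abs_bound)
  also have "\<dots> \<le> (\<integral>z. rate ^ n * (2 + beta * (V x + V z)) \<partial>\<pi>)"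
  proof (rule integral_mono)
    fix z assume "z \<in> space \<pi>"
    then have z: "z \<in> space M" using sets_eq_imp_space_eq[OF pi(2)] by simp
    show "\<bar>?\<psi> x - ?\<psi> z\<bar> \<le> rate ^ n * (2 + beta * (V x + V z))"
      using contraction_pow[OF A x z, of n] contraction_pow[OF A z x, of n] by (simp add: abs_if add.commute)
  qed (use i iV in auto)
  also have "\<dots> = rate ^ n * (2 + beta * (V x + (\<integral>z. V z \<partial>\<pi>)))"
    using iV by (simp add: pi.prob_space)
  also have "\<dots> \<le> rate ^ n * (2 + beta * (V x + L / (1 - lam)))"
    using invariant_integral_V(2)[OF pi inv] rate_nonneg beta_pos
    by (intro mult_left_mono add_mono) auto
  finally show ?thesis using 1 2 by (simp add: mult.commute)
qed

end

section \<open>Exponential moments and the hyperbolic cosine\<close>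

text \<open>From cosh x - 1 = 2 sinh(z)^2 with z = |x|/2, and sinh z <= z exp z, which is 1 -
  exp(-2z) <= 2z multiplied by exp(z)/2.\<close>

lemma cosh_minus_one_le:
  fixes x :: real
  shows "cosh x - 1 \<le> x\<^sup>2 / 2 * exp \<bar>x\<bar>"
proof -
  define z where "z = \<bar>x\<bar> / 2"
  have z: "0 \<le> z" by (simp add: z_def)
  have "1 - exp (- (2 * z)) \<le> 2 * z"
    using exp_ge_add_one_self[of "- (2 * z)"] by simp
  then have "exp z * (1 - exp (- (2 * z))) \<le> exp z * (2 * z)"
    by (intro mult_left_mono) auto
  moreover have "exp z * exp (- (2 * z)) = exp (- z)" by (simp add: exp_add[symmetric])
  ultimately have "sinh z \<le> z * exp z"
    by (simp add: sinh_field_def algebra_simps)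
  then have "(sinh z)\<^sup>2 \<le> (z * exp z)\<^sup>2"
    using z by (intro power_mono) auto
  moreover have "cosh \<bar>x\<bar> - 1 = 2 * (sinh z)\<^sup>2"
    using cosh_double[of z] cosh_square_eq[of z] by (simp add: z_def)
  ultimately have "cosh x - 1 \<le> 2 * (z * exp z)\<^sup>2" by simp
  also have "\<dots> = x\<^sup>2 / 2 * exp \<bar>x\<bar>"
    by (simp add: z_def power_mult_distrib exp_double[symmetric] power_divide)
  finally show ?thesis .
qed

text \<open>Both signs are the inequality exp v >= 1 + v, at v = -x and v = x. Thus the
  linearisation error of sinh is controlled by the same quantity as the second-order term of
  cosh.\<close>

lemma abs_sinh_minus_self_le:
  fixes x :: real
  shows "\<bar>sinh x - x\<bar> \<le> cosh x - 1"
proof -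
  have "sinh x - x \<le> cosh x - 1"
    using exp_ge_add_one_self[of "- x"] cosh_minus_sinh[of x] by linarith
  moreover have "x - sinh x \<le> cosh x - 1"
    using exp_ge_add_one_self[of x] cosh_plus_sinh[of x] by linarith
  ultimately show ?thesis by linarith
qed

lemma abs_sinh_le_cosh:
  fixes x :: real
  shows "\<bar>sinh x\<bar> \<le> cosh x"
  by (metis cosh_real_abs sinh_real_abs sinh_le_cosh_real)

lemma half_square_le_exp:
  fixes z :: real
  assumes "0 \<le> z"
  shows "z\<^sup>2 / 2 \<le> exp z"
  using exp_lower_Taylor_quadratic[OF assms] assms by simp

text \<open>Half of the exponent \<open>t\<close> absorbs the factor w^2, the other half absorbs
  exp|s w|. What remains is an explicit s^2 times a function that does not depend on
  \<open>s\<close>.\<close>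

lemma cosh_minus_one_le_exp:
  fixes s t w :: real
  assumes t: "0 < t" and s: "0 \<le> s" "s \<le> t / 2"
  shows "cosh (s * w) - 1 \<le> 4 / t\<^sup>2 * s\<^sup>2 * exp (t * \<bar>w\<bar>)"
proof -
  have "(t / 2 * \<bar>w\<bar>)\<^sup>2 / 2 \<le> exp (t / 2 * \<bar>w\<bar>)"
    using t by (intro half_square_le_exp) auto
  then have 1: "w\<^sup>2 / 2 \<le> 4 / t\<^sup>2 * exp (t / 2 * \<bar>w\<bar>)"
    using t by (simp add: power_mult_distrib power_divide field_simps)
  have 2: "exp \<bar>s * w\<bar> \<le> exp (t / 2 * \<bar>w\<bar>)"
  proof -
    have "s * \<bar>w\<bar> \<le> t / 2 * \<bar>w\<bar>" by (rule mult_right_mono) (use s in auto)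
    then show ?thesis using s by (simp add: abs_mult)
  qed
  have "cosh (s * w) - 1 \<le> s\<^sup>2 * (w\<^sup>2 / 2) * exp \<bar>s * w\<bar>"
    using cosh_minus_one_le[of "s * w"] by (simp add: power_mult_distrib)
  also have "\<dots> \<le> s\<^sup>2 * (4 / t\<^sup>2 * exp (t / 2 * \<bar>w\<bar>)) * exp (t / 2 * \<bar>w\<bar>)"
    using 1 2 by (intro mult_mono mult_left_mono) auto
  also have "\<dots> = 4 / t\<^sup>2 * s\<^sup>2 * (exp (t / 2 * \<bar>w\<bar>) * exp (t / 2 * \<bar>w\<bar>))"
    by simp
  also have "exp (t / 2 * \<bar>w\<bar>) * exp (t / 2 * \<bar>w\<bar>) = exp (t * \<bar>w\<bar>)"
    by (simp add: exp_add[symmetric])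
  finally show ?thesis .
qed

text \<open>Half of the tail rate is spent on the moment: for n < f <= n + 1 the integrand is at
  most exp(b(n+1)/2), while the tail beyond n has mass at most a exp(-b n), leaving a geometric
  series of ratio exp(-b/2). The summand 1 accounts for f <= 0. The bound depends on
  \<open>a\<close> and \<open>b\<close> only.\<close>

lemma exp_moment_of_tail:
  fixes f :: "'a \<Rightarrow> real"
  assumes N: "prob_space N" and f [measurable]: "f \<in> borel_measurable N" and b: "0 < b"
    and tail: "\<And>x. 0 \<le> x \<Longrightarrow> measure N {u \<in> space N. f u > x} \<le> a * exp (- b * x)"
  shows "(\<integral>\<^sup>+u. ennreal (exp (b / 2 * f u)) \<partial>N) \<le> ennreal (1 + a * exp (b / 2) / (1 - exp (- b / 2)))"
proof -
  interpret prob_space N by fact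
  have a: "0 \<le> a" using order_trans[OF measure_nonneg tail[of 0]] by simp
  define q where "q = exp (- b / 2)"
  have q: "0 < q" "q < 1" using b by (auto simp: q_def)
  let ?A = "\<lambda>n::nat. {u \<in> space N. f u > real n}"
  let ?t = "\<lambda>n::nat. exp (b / 2 * (real n + 1))"
  have term_le: "g n \<le> (\<Sum>n. g n)" for g :: "nat \<Rightarrow> ennreal" and n
    using sum_le_suminf[of g "{n}"] by (simp add: summableI)
  have "(\<integral>\<^sup>+u. ennreal (exp (b / 2 * f u)) \<partial>N)
      \<le> (\<integral>\<^sup>+u. 1 + (\<Sum>n. ennreal (?t n) * indicator (?A n) u) \<partial>N)"
  proof (rule nn_integral_mono)
    fix u assume u: "u \<in> space N"
    show "ennreal (exp (b / 2 * f u)) \<le> 1 + (\<Sum>n. ennreal (?t n) * indicator (?A n) u)"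
    proof (cases "f u \<le> 0")
      case True
      then have "exp (b / 2 * f u) \<le> 1" using b by (simp add: mult_nonneg_nonpos)
      then show ?thesis by (intro order_trans[OF _ add_increasing2[OF zero_le order_refl]]) simp
    next
      case False
      \<comment> \<open>Ceiling minus one rather than floor: the tail sets are strict, so an integer
        value of \<open>f u\<close> belongs to the slice below it.\<close>
      define n where "n = nat (\<lceil>f u\<rceil> - 1)"
      have n: "real n < f u" "f u \<le> real n + 1" using False by (auto simp: n_def) linarith+
      have "ennreal (exp (b / 2 * f u)) \<le> ennreal (?t n) * indicator (?A n) u"
        using n b u by (auto intro!: ennreal_leI)
      also have "\<dots> \<le> (\<Sum>n. ennreal (?t n) * indicator (?A n) u)"
        by (rule term_le)
      finally show ?thesis by (rule order_trans) simp
    qed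
  qed
  also have "\<dots> = 1 + (\<Sum>n. ennreal (?t n) * emeasure N (?A n))"
    by (subst nn_integral_add) (auto simp: nn_integral_suminf nn_integral_cmult emeasure_space_1)
  also have "\<dots> \<le> 1 + (\<Sum>n. ennreal (a * exp (b / 2) * q ^ n))"
  proof (intro add_left_mono suminf_le allI summableI)
    fix n :: nat
    have "ennreal (?t n) * emeasure N (?A n) \<le> ennreal (?t n) * ennreal (a * exp (- b * real n))"
      using tail[of "real n"] by (intro mult_left_mono) (auto simp: emeasure_eq_measure intro!: ennreal_leI)
    also have "\<dots> = ennreal (a * exp (b / 2) * q ^ n)"
      using a by (subst ennreal_mult[symmetric])
        (auto simp: q_def exp_of_nat_mult[symmetric] exp_add[symmetric] field_simps)
    finally show "ennreal (?t n) * emeasure N (?A n) \<le> ennreal (a * exp (b / 2) * q ^ n)" .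
  qed
  also have "(\<Sum>n. ennreal (a * exp (b / 2) * q ^ n)) = ennreal (a * exp (b / 2) / (1 - q))"
    using q a sums_mult[OF geometric_sums[of q], of "a * exp (b / 2)"] by (intro suminf_ennreal_eq) auto
  also have "1 + ennreal (a * exp (b / 2) / (1 - q)) = ennreal (1 + a * exp (b / 2) / (1 - q))"
    using q a by (subst ennreal_plus) auto
  finally show ?thesis by (simp add: q_def)
qed

locale exp_moment = prob_space N for N :: "'a measure" +
  fixes W :: "'a \<Rightarrow> real" and t D :: real
  assumes W_measurable [measurable]: "W \<in> borel_measurable N" and t_pos: "0 < t"
    and moment: "(\<integral>\<^sup>+u. ennreal (exp (t * \<bar>W u\<bar>)) \<partial>N) \<le> ennreal D"
begin

lemma integrable_exp: "integrable N (\<lambda>u. exp (t * \<bar>W u\<bar>))"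
  using moment by (intro integrableI_nonneg) (auto simp: less_top[symmetric] top_unique)

lemma D_ge_1: "1 \<le> D" and expectation_exp_le: "expectation (\<lambda>u. exp (t * \<bar>W u\<bar>)) \<le> D"
proof -
  have 1: "1 \<le> expectation (\<lambda>u. exp (t * \<bar>W u\<bar>))"
    using t_pos by (intro integral_ge_const integrable_exp) auto
  have "ennreal (expectation (\<lambda>u. exp (t * \<bar>W u\<bar>))) \<le> ennreal D"
    using moment by (subst (asm) nn_integral_eq_integral[OF integrable_exp]) auto
  then show "expectation (\<lambda>u. exp (t * \<bar>W u\<bar>)) \<le> D"
    \<comment> \<open>A negative \<open>D\<close> would be read as 0 by \<open>ennreal\<close>,
      contradicting a moment of at least 1.\<close>
    using 1 by (cases "0 \<le> D") (auto simp: ennreal_neg)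
  with 1 show "1 \<le> D" by simp
qed

lemma integrable_W: "integrable N W" and expectation_abs_le: "\<bar>expectation W\<bar> \<le> D / t"
proof -
  have le: "\<bar>W u\<bar> \<le> exp (t * \<bar>W u\<bar>) / t" for u
  proof -
    have "t * \<bar>W u\<bar> \<le> exp (t * \<bar>W u\<bar>)"
      using exp_ge_add_one_self[of "t * \<bar>W u\<bar>"] by linarith
    then show ?thesis using t_pos by (simp add: field_simps)
  qed
  have i: "integrable N (\<lambda>u. exp (t * \<bar>W u\<bar>) / t)"
    using integrable_exp by simp
  show iW: "integrable N W"
    by (rule Bochner_Integration.integrable_bound[OF i]) (use le t_pos in auto)
  have "\<bar>expectation W\<bar> \<le> expectation (\<lambda>u. \<bar>W u\<bar>)" by (rule integral_abs_bound)
  also have "\<dots> \<le> expectation (\<lambda>u. exp (t * \<bar>W u\<bar>) / t)"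
    using le iW i by (intro integral_mono) auto
  also have "\<dots> \<le> D / t"
    using expectation_exp_le t_pos by (simp add: divide_right_mono)
  finally show "\<bar>expectation W\<bar> \<le> D / t" .
qed

text \<open>The s^2 coefficient of \<open>cosh_minus_one_le_exp\<close> times the moment bound; it
  depends on \<open>t\<close> and \<open>D\<close> only.\<close>

definition "C = 4 * D / t\<^sup>2"

lemma C_nonneg: "0 \<le> C"
  using D_ge_1 t_pos by (simp add: C_def)

section \<open>Expansion of the moments in a small exponent\<close>

context
  fixes s :: real assumes s: "0 \<le> s" "s \<le> t / 2"
begin

lemma integrable_cosh: "integrable N (\<lambda>u. cosh (s * W u))"
proof (rule Bochner_Integration.integrable_bound)
  show "integrable N (\<lambda>u. 1 + 4 / t\<^sup>2 * s\<^sup>2 * exp (t * \<bar>W u\<bar>))"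
    using integrable_exp by simp
  show "AE u in N. norm (cosh (s * W u)) \<le> norm (1 + 4 / t\<^sup>2 * s\<^sup>2 * exp (t * \<bar>W u\<bar>))"
  proof (rule AE_I2)
    fix u
    have "cosh (s * W u) \<le> 1 + 4 / t\<^sup>2 * s\<^sup>2 * exp (t * \<bar>W u\<bar>)"
      using cosh_minus_one_le_exp[OF t_pos s, of "W u"] by linarith
    moreover have "0 \<le> cosh (s * W u)" by simp
    ultimately show "norm (cosh (s * W u)) \<le> norm (1 + 4 / t\<^sup>2 * s\<^sup>2 * exp (t * \<bar>W u\<bar>))"
      unfolding real_norm_def by linarith
  qed
qed (auto intro!: borel_measurable_continuous_on[where f = cosh] continuous_intros)

lemma integrable_sinh: "integrable N (\<lambda>u. sinh (s * W u))"
proof (rule Bochner_Integration.integrable_bound[OF integrable_cosh])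
  show "AE u in N. norm (sinh (s * W u)) \<le> norm (cosh (s * W u))"
    using abs_sinh_le_cosh by (intro AE_I2) simp
qed (auto intro!: borel_measurable_continuous_on[where f = sinh] continuous_intros)

lemma expectation_cosh_minus_1: "expectation (\<lambda>u. cosh (s * W u) - 1) \<le> C * s\<^sup>2"
proof -
  have "expectation (\<lambda>u. cosh (s * W u) - 1) \<le> expectation (\<lambda>u. 4 / t\<^sup>2 * s\<^sup>2 * exp (t * \<bar>W u\<bar>))"
    using cosh_minus_one_le_exp[OF t_pos s] integrable_cosh integrable_exp by (intro integral_mono) auto
  also have "\<dots> \<le> 4 / t\<^sup>2 * s\<^sup>2 * D"
    using expectation_exp_le by (simp add: mult_left_mono divide_right_mono)
  finally show ?thesis by (simp add: C_def ac_simps)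
qed

lemma expectation_cosh_le: "expectation (\<lambda>u. cosh (s * W u)) \<le> 1 + C * s\<^sup>2"
  using expectation_cosh_minus_1 integrable_cosh by (simp add: prob_space)

lemma expectation_sinh_approx: "\<bar>expectation (\<lambda>u. sinh (s * W u)) - s * expectation W\<bar> \<le> C * s\<^sup>2"
proof -
  have "expectation (\<lambda>u. sinh (s * W u)) - s * expectation W = expectation (\<lambda>u. sinh (s * W u) - s * W u)"
    using integrable_sinh integrable_W by simp
  also have "\<bar>\<dots>\<bar> \<le> expectation (\<lambda>u. \<bar>sinh (s * W u) - s * W u\<bar>)" by (rule integral_abs_bound)
  also have "\<dots> \<le> expectation (\<lambda>u. cosh (s * W u) - 1)"
    using abs_sinh_minus_self_le integrable_sinh integrable_W integrable_cosh by (intro integral_mono) auto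
  also have "\<dots> \<le> C * s\<^sup>2" by (rule expectation_cosh_minus_1)
  finally show ?thesis .
qed

lemma integrable_cosh_add: "integrable N (\<lambda>u. cosh (s * (p + W u)))"
  unfolding distrib_left cosh_add using integrable_cosh integrable_sinh by simp

lemma expectation_cosh_add:
  "expectation (\<lambda>u. cosh (s * (p + W u))) =
    cosh (s * p) * expectation (\<lambda>u. cosh (s * W u)) + sinh (s * p) * expectation (\<lambda>u. sinh (s * W u))"
  unfolding distrib_left cosh_add using integrable_cosh integrable_sinh by simp

text \<open>In the addition formula the cosh moment is at most 1 + C s^2 and the sinh moment is s
  times the mean up to C s^2. Since |sinh| <= cosh, both errors are relative to cosh(s p).\<close>

lemma expectation_cosh_add_le:
  "expectation (\<lambda>u. cosh (s * (p + W u))) \<le>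
    cosh (s * p) * (1 + 2 * C * s\<^sup>2) + s * (sinh (s * p) * expectation W)"
proof -
  have 1: "\<bar>sinh (s * p)\<bar> \<le> cosh (s * p)"
    by (rule abs_sinh_le_cosh)
  have "sinh (s * p) * expectation (\<lambda>u. sinh (s * W u)) - sinh (s * p) * (s * expectation W)
      \<le> \<bar>sinh (s * p)\<bar> * \<bar>expectation (\<lambda>u. sinh (s * W u)) - s * expectation W\<bar>"
    by (simp add: right_diff_distrib[symmetric] abs_mult[symmetric])
  also have "\<dots> \<le> cosh (s * p) * (C * s\<^sup>2)"
    using 1 expectation_sinh_approx by (intro mult_mono) auto
  finally have "sinh (s * p) * expectation (\<lambda>u. sinh (s * W u))
      \<le> s * (sinh (s * p) * expectation W) + cosh (s * p) * (C * s\<^sup>2)"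
    by (simp add: ac_simps)
  moreover have "cosh (s * p) * expectation (\<lambda>u. cosh (s * W u)) \<le> cosh (s * p) * (1 + C * s\<^sup>2)"
    using expectation_cosh_le by (intro mult_left_mono) auto
  ultimately show ?thesis
    unfolding expectation_cosh_add by (simp add: algebra_simps)
qed

text \<open>Outside [-k, k] the mean term is at most -d |sinh(s p)|, and |sinh| >= cosh - 1 turns
  this into a multiple of cosh at the additive cost s*d. Inside, cosh(s p) <= cosh(s k) and the
  crude bound D/t on the mean suffice.\<close>

lemma expectation_cosh_drift:
  assumes "0 < d" and sd: "s * d \<le> 1" and mean: "\<bar>p\<bar> > k \<Longrightarrow> sgn p * expectation W \<le> - d"
  shows "expectation (\<lambda>u. cosh (s * (p + W u))) \<le>
    (1 + 2 * C * s\<^sup>2 - s * d) * cosh (s * p) + (s * d + cosh (s * k) * (1 + 2 * C * s\<^sup>2 + s * (D / t)))"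
proof (cases "\<bar>p\<bar> > k")
  case True
  have "\<bar>sinh (s * p)\<bar> = sgn p * sinh (s * p)"
    using s by (cases p "0::real" rule: linorder_cases) (auto simp: abs_of_nonneg abs_of_nonpos mult_nonneg_nonpos)
  then have "sinh (s * p) * expectation W = \<bar>sinh (s * p)\<bar> * (sgn p * expectation W)"
    by (cases p "0::real" rule: linorder_cases) auto
  also have "\<dots> \<le> \<bar>sinh (s * p)\<bar> * (- d)"
    using mean[OF True] by (intro mult_left_mono) auto
  also have "cosh (s * p) - 1 \<le> \<bar>sinh (s * p)\<bar>"
  proof -
    have "cosh \<bar>s * p\<bar> - sinh \<bar>s * p\<bar> \<le> 1" by (simp only: cosh_minus_sinh) simp
    then show ?thesis by simp
  qed
  then have "\<bar>sinh (s * p)\<bar> * (- d) \<le> (cosh (s * p) - 1) * (- d)"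
    using assms(1) by (simp add: mult_right_mono)
  finally have "s * (sinh (s * p) * expectation W) \<le> s * ((cosh (s * p) - 1) * (- d))"
    using s by (intro mult_left_mono) auto
  then have "expectation (\<lambda>u. cosh (s * (p + W u))) \<le> (1 + 2 * C * s\<^sup>2 - s * d) * cosh (s * p) + s * d"
    using expectation_cosh_add_le[of p] by (simp add: algebra_simps)
  moreover have "0 \<le> cosh (s * k) * (1 + 2 * C * s\<^sup>2 + s * (D / t))"
    using s C_nonneg D_ge_1 t_pos by simp
  ultimately show ?thesis by linarith
next
  case False
  have c: "cosh (s * p) \<le> cosh (s * k)"
  proof -
    have "\<bar>s * p\<bar> \<le> s * k" using False s by (simp add: abs_mult mult_left_mono)
    then have "cosh \<bar>s * p\<bar> \<le> cosh (s * k)" by (subst cosh_real_nonneg_le_iff) auto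
    then show ?thesis by simp
  qed
  have "\<bar>sinh (s * p)\<bar> \<le> cosh (s * p)"
    by (rule abs_sinh_le_cosh)
  then have "\<bar>sinh (s * p)\<bar> * \<bar>expectation W\<bar> \<le> cosh (s * p) * (D / t)"
    using expectation_abs_le by (intro mult_mono) auto
  then have "sinh (s * p) * expectation W \<le> cosh (s * p) * (D / t)"
    by (simp add: abs_mult[symmetric])
  then have "s * (sinh (s * p) * expectation W) \<le> s * (cosh (s * p) * (D / t))"
    using s by (intro mult_left_mono) auto
  then have "expectation (\<lambda>u. cosh (s * (p + W u))) \<le> cosh (s * p) * (1 + 2 * C * s\<^sup>2 + s * (D / t))"
    using expectation_cosh_add_le[of p] by (simp add: algebra_simps)
  also have "\<dots> \<le> cosh (s * k) * (1 + 2 * C * s\<^sup>2 + s * (D / t))"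
    using c s C_nonneg D_ge_1 t_pos by (intro mult_right_mono) auto
  \<comment> \<open>Here s*d <= 1 enters: it keeps the coefficient of cosh(s p) nonnegative, so this
    part of the bound may be added for free.\<close>
  also have "0 \<le> (1 + 2 * C * s\<^sup>2 - s * d) * cosh (s * p) + s * d"
    using s assms C_nonneg by (intro add_nonneg_nonneg mult_nonneg_nonneg) (auto intro: add_increasing2)
  ultimately show ?thesis by linarith
qed

end
end

lemma small_exponent_exists:
  fixes A B d s0 :: real
  assumes "0 \<le> A" "0 \<le> B" "0 < d" "0 < s0"
  shows "\<exists>s. 0 < s \<and> s \<le> s0 \<and> s * d \<le> 1 \<and> (1 + A * s\<^sup>2 - s * d) * (1 + B * s\<^sup>2) < 1"
proof -
  \<comment> \<open>The product is 1 - s*d + s^2 (A + B + A B s^2 - d B s), and for s <= 1 the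
    bracket is at most \<open>E\<close>. The summand 1 keeps \<open>E\<close> positive when
    \<open>A\<close> and \<open>B\<close> vanish; s <= d/(2E) makes s*E at most d/2.\<close>
  define E where "E = A + B + A * B + 1"
  have E: "0 < E" using assms by (simp add: E_def add_nonneg_pos)
  define s where "s = min (min s0 1) (min (1 / d) (d / (2 * E)))"
  have s: "0 < s" "s \<le> s0" "s \<le> 1" "s \<le> 1 / d" "s \<le> d / (2 * E)"
    using assms E by (auto simp: s_def)
  have "s\<^sup>2 * (A * B) \<le> A * B"
    using s assms by (intro mult_left_le_one_le) (auto simp: power_le_one)
  then have "A + B + A * B * s\<^sup>2 - d * B * s \<le> E"
  proof -
    have "0 \<le> d * B * s" using s assms by simp
    then show ?thesis
      using \<open>s\<^sup>2 * (A * B) \<le> A * B\<close> by (simp add: E_def mult.commute)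
  qed
  then have "s * (A + B + A * B * s\<^sup>2 - d * B * s) \<le> s * E"
    using s by (intro mult_left_mono) auto
  also have "\<dots> < d"
    using s(5) E assms by (simp add: field_simps)
  finally have "s * (s * (A + B + A * B * s\<^sup>2 - d * B * s)) < s * d"
    using s by simp
  moreover have "(1 + A * s\<^sup>2 - s * d) * (1 + B * s\<^sup>2)
      = 1 - s * d + s * (s * (A + B + A * B * s\<^sup>2 - d * B * s))"
    by (simp add: algebra_simps power2_eq_square)
  moreover have "s * d \<le> 1" using s(4) assms by (simp add: field_simps)
  ultimately show ?thesis using s by (intro exI[of _ s]) auto
qed

section \<open>Two-block Gibbs samplers with symmetric noise\<close>

lemma density_kernel_measurable:
  fixes p :: "real \<Rightarrow> real \<Rightarrow> real"
  assumes [measurable]: "(\<lambda>(x, z). p x z) \<in> borel_measurable (borel \<Otimes>\<^sub>M borel)"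
    and 1: "\<And>x. (\<integral>\<^sup>+z. ennreal (p x z) \<partial>lborel) = 1"
  shows "(\<lambda>x. density lborel (\<lambda>z. ennreal (p x z))) \<in> borel \<rightarrow>\<^sub>M prob_algebra borel"
proof (rule measurable_prob_algebraI)
  have m [measurable]: "p x \<in> borel_measurable borel" for x
    by (rule measurable_compose[of "\<lambda>z. (x, z)" _ "borel \<Otimes>\<^sub>M borel" "\<lambda>(x, z). p x z", simplified]) auto
  show *: "prob_space (density lborel (\<lambda>z. ennreal (p x z)))" for x
    by (rule prob_spaceI) (simp add: emeasure_density 1)
  show "(\<lambda>x. density lborel (\<lambda>z. ennreal (p x z))) \<in> borel \<rightarrow>\<^sub>M subprob_algebra borel"
  proof (rule measurable_subprob_algebra)
    fix A :: "real set" assume [measurable]: "A \<in> sets borel"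
    have "(\<lambda>x. \<integral>\<^sup>+z. ennreal (p x z) * indicator A z \<partial>lborel) \<in> borel_measurable borel"
      by measurable
    then show "(\<lambda>x. emeasure (density lborel (\<lambda>z. ennreal (p x z))) A) \<in> borel_measurable borel"
      by (simp add: emeasure_density)
  qed (use * in \<open>auto intro: prob_space_imp_subprob_space\<close>)
qed

text \<open>\<open>g\<close> cannot be required to be a \<open>noise_density\<close>, since f1(y -
  .) is symmetric about y rather than 0; only the noise of the second half-step has to be even.
  Modulus 1 of \<open>sg\<close> makes \<open>T\<close> preserve Lebesgue measure.\<close>

locale two_block_gibbs =
  fixes g h :: "real \<Rightarrow> real" and sg ta :: real and j :: "real \<Rightarrow> real \<Rightarrow> real"
  assumes g: "continuous_on UNIV g" "bounded (range g)" "\<And>u. 0 < g u"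
      "integrable lborel g" "(\<integral>u. g u \<partial>lborel) = 1"
    and h: "noise_density h" and sg: "\<bar>sg\<bar> = 1"
    and j_eq: "\<And>u \<theta>. j u \<theta> = g u * h (u - (sg * \<theta> + ta))"
begin

definition T :: "real \<Rightarrow> real" where "T \<theta> = sg * \<theta> + ta"

lemma j_T: "j u \<theta> = g u * h (u - T \<theta>)"
  by (simp add: j_eq T_def)

lemma g_measurable [measurable]: "g \<in> borel_measurable borel"
  using g(1) by (rule borel_measurable_continuous_onI)

lemma h_measurable [measurable]: "h \<in> borel_measurable borel"
  using h by (auto simp: noise_density_def intro: borel_measurable_continuous_onI)

lemma T_measurable [measurable]: "T \<in> borel_measurable borel"
  unfolding T_def[abs_def] by measurable

lemma h_pos: "0 < h z" and h_even: "h (- z) = h z"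
  using h by (auto simp: noise_density_def)

lemma g_nonneg [simp]: "0 \<le> g u" and h_nonneg [simp]: "0 \<le> h z"
  using g(3)[of u] h_pos[of z] by auto

lemma nn_integral_g: "(\<integral>\<^sup>+u. ennreal (g u) \<partial>lborel) = 1"
  using g by (subst nn_integral_eq_integral) auto

lemma nn_integral_h: "(\<integral>\<^sup>+z. ennreal (h z) \<partial>lborel) = 1"
  using h by (subst nn_integral_eq_integral) (auto simp: noise_density_def)

lemma nn_integral_T:
  assumes [measurable]: "f \<in> borel_measurable borel"
  shows "(\<integral>\<^sup>+\<theta>. f (u - T \<theta>) \<partial>lborel) = (\<integral>\<^sup>+z. f z \<partial>lborel)"
  using nn_integral_real_affine[of f "- sg" "u - ta"] sg
  by (force simp: T_def algebra_simps)

lemma nn_integral_h_T: "(\<integral>\<^sup>+\<theta>. ennreal (h (u - T \<theta>)) \<partial>lborel) = 1"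
  using nn_integral_T[of "\<lambda>z. ennreal (h z)" u] nn_integral_h by simp

lemma nn_integral_h_shift: "(\<integral>\<^sup>+u. ennreal (h (u - p)) \<partial>lborel) = 1"
  using nn_integral_real_affine[of "\<lambda>z. ennreal (h z)" 1 "- p"] nn_integral_h by simp

definition G :: real where "G = (SOME b. \<forall>u. g u \<le> b)"

lemma g_le_G: "g u \<le> G"
proof -
  have "\<exists>b. \<forall>u. g u \<le> b"
    using g(2) unfolding bounded_iff by (metis abs_le_D1 rangeI real_norm_def)
  from someI_ex[OF this] show ?thesis by (simp add: G_def)
qed

lemma G_pos: "0 < G"
  using g(3)[of 0] g_le_G[of 0] by linarith

text \<open>Plays two roles: the normalising constant of \<open>cond_U\<close> and the marginal
  posterior density of \<theta>. Their cancellation gives invariance.\<close>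

definition c :: "real \<Rightarrow> real" where "c \<theta> = (\<integral>u. j u \<theta> \<partial>lborel)"

lemma j_measurable [measurable]: "(\<lambda>(u, \<theta>). j u \<theta>) \<in> borel_measurable (borel \<Otimes>\<^sub>M borel)"
  unfolding j_T by measurable

lemma j_nonneg [simp]: "0 \<le> j u \<theta>"
  by (simp add: j_T)

lemma nn_integral_j_le: "(\<integral>\<^sup>+u. ennreal (j u \<theta>) \<partial>lborel) \<le> ennreal G"
proof -
  have "(\<integral>\<^sup>+u. ennreal (j u \<theta>) \<partial>lborel) \<le> (\<integral>\<^sup>+u. ennreal G * ennreal (h (u - T \<theta>)) \<partial>lborel)"
    unfolding j_T using g_le_G G_pos
    by (intro nn_integral_mono) (auto simp: ennreal_mult[symmetric] intro!: ennreal_leI mult_right_mono)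
  also have "\<dots> = ennreal G"
    by (simp add: nn_integral_cmult nn_integral_h_shift)
  finally show ?thesis .
qed

lemma integrable_j: "integrable lborel (\<lambda>u. j u \<theta>)"
  using nn_integral_j_le[of \<theta>]
  by (intro integrableI_nonneg) (auto simp: less_top[symmetric] top_unique)

lemma nn_integral_j: "(\<integral>\<^sup>+u. ennreal (j u \<theta>) \<partial>lborel) = ennreal (c \<theta>)"
  unfolding c_def by (intro nn_integral_eq_integral integrable_j) simp

lemma c_le: "c \<theta> \<le> G"
  using nn_integral_j_le[of \<theta>] G_pos by (simp add: nn_integral_j)

lemma c_pos: "0 < c \<theta>"
proof (rule ccontr)
  assume "\<not> 0 < c \<theta>"
  then have "(\<integral>\<^sup>+u. ennreal (j u \<theta>) \<partial>lborel) = 0"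
    by (simp add: nn_integral_j ennreal_neg)
  then have "AE u in lborel. ennreal (j u \<theta>) = 0"
    by (subst (asm) nn_integral_0_iff_AE) auto
  then have "AE u in (lborel :: real measure). False"
    by eventually_elim (use g(3) h_pos in \<open>simp add: j_T mult_le_0_iff not_le[symmetric] ennreal_eq_0_iff\<close>)
  then show False 
    by (auto simp: eventually_ae_filter null_sets_def top.extremum_unique)
qed

lemma c_measurable [measurable]: "c \<in> borel_measurable borel"
  unfolding c_def[abs_def] by measurable

section \<open>The two conditional laws, the Gibbs kernel and the posterior\<close>

lemma cond_U_eq: "cond_U j \<theta> = density lborel (\<lambda>u. ennreal (j u \<theta> / c \<theta>))"
  by (simp add: cond_U_def ndens_def c_def)

text \<open>\<open>g u\<close> cancels in the normalisation, and \<open>h\<close> keeps mass 1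
  because \<open>T\<close> preserves Lebesgue measure.\<close>

lemma cond_Theta_eq: "cond_Theta j u = density lborel (\<lambda>\<theta>. ennreal (h (u - T \<theta>)))"
proof -
  have "integrable lborel (\<lambda>\<theta>. h (u - T \<theta>))"
    using nn_integral_h_T[of u] by (intro integrableI_nonneg) auto
  then have "(\<integral>\<theta>. h (u - T \<theta>) \<partial>lborel) = 1"
    using nn_integral_eq_integral[of lborel "\<lambda>\<theta>. h (u - T \<theta>)"] nn_integral_h_T[of u]
    by (simp add: ennreal_eq_1)
  then show ?thesis
    using g(3)[of u] by (simp add: cond_Theta_def ndens_def j_T)
qed

lemma cond_U_measurable [measurable]: "cond_U j \<in> borel \<rightarrow>\<^sub>M prob_algebra borel"
  unfolding cond_U_eq[abs_def]
proof (rule density_kernel_measurable)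
  show "(\<integral>\<^sup>+u. ennreal (j u \<theta> / c \<theta>) \<partial>lborel) = 1" for \<theta>
    using c_pos[of \<theta>] nn_integral_divide[of "\<lambda>u. ennreal (j u \<theta>)" lborel "ennreal (c \<theta>)"]
    by (simp add: divide_ennreal nn_integral_j ennreal_divide_self)
qed measurable

lemma cond_Theta_measurable [measurable]: "cond_Theta j \<in> borel \<rightarrow>\<^sub>M prob_algebra borel"
  unfolding cond_Theta_eq[abs_def]
  by (rule density_kernel_measurable) (auto simp: nn_integral_h_T)

lemma gibbs_measurable [measurable]: "gibbs_kernel j \<in> borel \<rightarrow>\<^sub>M prob_algebra borel"
  unfolding gibbs_kernel_def[abs_def] by measurable

lemma cond_Theta_measurable' [measurable]: "cond_Theta j \<in> borel \<rightarrow>\<^sub>M subprob_algebra borel"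
  by (rule measurable_prob_algebraD) (rule cond_Theta_measurable)

lemma sets_cond_U [simp, measurable_cong]: "sets (cond_U j \<theta>) = sets borel"
  and sets_cond_Theta [simp, measurable_cong]: "sets (cond_Theta j u) = sets borel"
  and space_cond_U [simp]: "space (cond_U j \<theta>) = UNIV"
  by (simp_all add: cond_U_def cond_Theta_def ndens_def)

lemma prob_space_cond_U: "prob_space (cond_U j \<theta>)"
  using measurable_space[OF cond_U_measurable, of \<theta>] by (simp add: space_prob_algebra)

lemma cond_Theta_measurable_cond_U [measurable]: "cond_Theta j \<in> cond_U j \<theta> \<rightarrow>\<^sub>M subprob_algebra borel"
  using cond_Theta_measurable' by (simp cong: measurable_cong_sets)

lemma emeasure_gibbs:
  assumes "A \<in> sets borel"
  shows "emeasure (gibbs_kernel j \<theta>) A = (\<integral>\<^sup>+u. emeasure (cond_Theta j u) A \<partial>cond_U j \<theta>)"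
  unfolding gibbs_kernel_def using assms by (intro emeasure_bind[where N = borel]) auto

lemma emeasure_cond_Theta_measurable [measurable]:
  "A \<in> sets borel \<Longrightarrow> (\<lambda>u. emeasure (cond_Theta j u) A) \<in> borel_measurable borel"
  by (rule measurable_compose[OF cond_Theta_measurable' measurable_emeasure_subprob_algebra])

text \<open>By Tonelli the total mass of \<open>j\<close> is 1: integrating \<theta> first removes
  \<open>h\<close>, and then \<open>g\<close> integrates to 1. So \<open>c\<close> is already
  normalised.\<close>

lemma post_theta_eq: "post_theta j = density lborel (\<lambda>\<theta>. ennreal (c \<theta>))"
  and prob_space_post: "prob_space (post_theta j)"
proof -
  have "(\<integral>\<^sup>+\<theta>. ennreal (c \<theta>) \<partial>lborel) = (\<integral>\<^sup>+\<theta>. \<integral>\<^sup>+u. ennreal (j u \<theta>) \<partial>lborel \<partial>lborel)"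
    by (simp add: nn_integral_j)
  also have "\<dots> = (\<integral>\<^sup>+u. \<integral>\<^sup>+\<theta>. ennreal (j u \<theta>) \<partial>lborel \<partial>lborel)"
    by (rule lborel_pair.Fubini') measurable
  also have "\<dots> = (\<integral>\<^sup>+u. ennreal (g u) * (\<integral>\<^sup>+\<theta>. ennreal (h (u - T \<theta>)) \<partial>lborel) \<partial>lborel)"
    by (simp add: j_T ennreal_mult nn_integral_cmult)
  also have "\<dots> = 1" by (simp add: nn_integral_h_T nn_integral_g)
  finally have 1: "(\<integral>\<^sup>+\<theta>. ennreal (c \<theta>) \<partial>lborel) = 1" .
  have nn: "0 \<le> c \<theta>" for \<theta> using c_pos[of \<theta>] by simp
  have "integrable lborel c"
    using 1 nn by (intro integrableI_nonneg) auto
  then have "(\<integral>\<theta>. c \<theta> \<partial>lborel) = 1"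
    using nn_integral_eq_integral[of lborel c] 1 nn by (simp add: ennreal_eq_1)
  then show *: "post_theta j = density lborel (\<lambda>\<theta>. ennreal (c \<theta>))"
    by (simp add: post_theta_def ndens_def c_def[symmetric])
  show "prob_space (post_theta j)"
    unfolding * by (rule prob_spaceI) (simp add: emeasure_density 1)
qed

lemma sets_post [simp, measurable_cong]: "sets (post_theta j) = sets borel"
  by (simp add: post_theta_eq)

text \<open>The posterior weight \<open>c \<theta>\<close> cancels the normalising constant of
  \<open>cond_U\<close>, leaving the joint density. Integrating out the old \<theta> gives
  \<open>g\<close>, and the new \<theta> drawn given \<open>u\<close> restores the joint
  density.\<close>

lemma post_invariant: "post_theta j \<bind> gibbs_kernel j = post_theta j"
proof (rule measure_eqI)
  have *: "post_theta j \<in> space (prob_algebra borel)"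
    using prob_space_post by (simp add: space_prob_algebra)
  show s: "sets (post_theta j \<bind> gibbs_kernel j) = sets (post_theta j)"
    using measurable_space[OF gibbs_measurable]
    by (subst sets_bind[where N = borel]) (auto simp: space_prob_algebra post_theta_eq)
  fix A assume "A \<in> sets (post_theta j \<bind> gibbs_kernel j)"
  then have A [measurable]: "A \<in> sets borel" by (simp add: s)
  let ?q = "\<lambda>u. emeasure (cond_Theta j u) A"
  have "emeasure (post_theta j \<bind> gibbs_kernel j) A = (\<integral>\<^sup>+\<theta>. (\<integral>\<^sup>+u. ?q u \<partial>cond_U j \<theta>) \<partial>post_theta j)"
    using emeasure_bind_prob_algebra[OF * gibbs_measurable A] by (simp add: emeasure_gibbs)
  also have "\<dots> = (\<integral>\<^sup>+\<theta>. (\<integral>\<^sup>+u. ennreal (j u \<theta> / c \<theta>) * ?q u \<partial>lborel) \<partial>post_theta j)"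
    by (simp add: cond_U_eq nn_integral_density)
  also have "\<dots> = (\<integral>\<^sup>+\<theta>. ennreal (c \<theta>) * (\<integral>\<^sup>+u. ennreal (j u \<theta> / c \<theta>) * ?q u \<partial>lborel) \<partial>lborel)"
    unfolding post_theta_eq by (rule nn_integral_density) measurable
  also have "\<dots> = (\<integral>\<^sup>+\<theta>. \<integral>\<^sup>+u. ennreal (j u \<theta>) * ?q u \<partial>lborel \<partial>lborel)"
    using c_pos by (simp add: nn_integral_cmult[symmetric] mult.assoc[symmetric] ennreal_mult[symmetric]
      order.strict_implies_order less_imp_neq[THEN not_sym])
  also have "\<dots> = (\<integral>\<^sup>+u. \<integral>\<^sup>+\<theta>. ennreal (j u \<theta>) * ?q u \<partial>lborel \<partial>lborel)"
    by (rule lborel_pair.Fubini') measurable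
  also have "\<dots> = (\<integral>\<^sup>+u. ennreal (g u) * ?q u * (\<integral>\<^sup>+\<theta>. ennreal (h (u - T \<theta>)) \<partial>lborel) \<partial>lborel)"
    by (simp add: j_T ennreal_mult nn_integral_cmult[symmetric] ac_simps)
  also have "\<dots> = (\<integral>\<^sup>+u. \<integral>\<^sup>+\<theta>. ennreal (j u \<theta>) * indicator A \<theta> \<partial>lborel \<partial>lborel)"
    by (simp add: nn_integral_h_T cond_Theta_eq emeasure_density nn_integral_cmult[symmetric]
      j_T ennreal_mult ac_simps)
  also have "\<dots> = (\<integral>\<^sup>+\<theta>. \<integral>\<^sup>+u. ennreal (j u \<theta>) * indicator A \<theta> \<partial>lborel \<partial>lborel)"
    by (rule lborel_pair.Fubini'[symmetric]) measurable
  also have "\<dots> = emeasure (post_theta j) A"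
    by (simp add: nn_integral_multc nn_integral_j post_theta_eq emeasure_density)
  finally show "emeasure (post_theta j \<bind> gibbs_kernel j) A = emeasure (post_theta j) A" .
qed

lemma cond_U_density_lower_bound:
  "\<exists>e>0. \<forall>\<theta> u. \<bar>T \<theta>\<bar> \<le> R \<longrightarrow> 0 \<le> u \<longrightarrow> u \<le> 1 \<longrightarrow> e \<le> j u \<theta> / c \<theta>"
proof -
  let ?f = "\<lambda>(u, p). g u * h (u - p)"
  \<comment> \<open>The unit interval is an arbitrary choice; the absolute value of \<open>R\<close>
    keeps the box nonempty for negative \<open>R\<close>.\<close>
  let ?S = "{0..1::real} \<times> {- \<bar>R\<bar>..\<bar>R\<bar>}"
  have "compact ?S" by (intro compact_Times) auto
  have "?S \<noteq> {}" by auto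
  have "continuous_on UNIV h" using h by (simp add: noise_density_def)
  then have "continuous_on ?S (\<lambda>v. h (fst v - snd v))"
    by (rule continuous_on_compose2) (auto intro!: continuous_intros)
  moreover have "continuous_on ?S (\<lambda>v. g (fst v))"
    using g(1) by (rule continuous_on_compose2) (auto intro!: continuous_intros)
  ultimately have "continuous_on ?S ?f"
    unfolding case_prod_beta by (intro continuous_on_mult)
  from continuous_attains_inf[OF \<open>compact ?S\<close> \<open>?S \<noteq> {}\<close> this]
  obtain m where m: "m \<in> ?S" "\<forall>v\<in>?S. ?f m \<le> ?f v" by (rule bexE)
  have fm: "0 < ?f m" using g(3) h_pos by (simp add: case_prod_beta)
  have "?f m / G \<le> j u \<theta> / c \<theta>" if "\<bar>T \<theta>\<bar> \<le> R" "0 \<le> u" "u \<le> 1" for u \<theta>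
  proof -
    have "?f m \<le> j u \<theta>"
    proof -
      have "(u, T \<theta>) \<in> ?S" using that by auto
      from bspec[OF m(2) this] show ?thesis by (simp add: j_T)
    qed
    then show ?thesis
      using c_pos[of \<theta>] c_le[of \<theta>] fm by (intro frac_le) auto
  qed
  then show ?thesis using fm G_pos by (intro exI[of _ "?f m / G"]) auto
qed

text \<open>On the small set the law of U dominates a multiple of the uniform law on [0,1], and the
  second half-step sees \<theta> only through U. Hence \<nu>, the image of the uniform law under
  \<open>cond_Theta\<close>, does not depend on \<theta>.\<close>

lemma minorization:
  "\<exists>e>0. \<exists>\<nu>. prob_space \<nu> \<and> sets \<nu> = sets borel \<and>
    (\<forall>\<theta> A. \<bar>T \<theta>\<bar> \<le> R \<longrightarrow> A \<in> sets borel \<longrightarrow> ennreal e * emeasure \<nu> A \<le> emeasure (gibbs_kernel j \<theta>) A)"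
proof -
  obtain e where e: "0 < e" "\<And>\<theta> u. \<bar>T \<theta>\<bar> \<le> R \<Longrightarrow> 0 \<le> u \<Longrightarrow> u \<le> 1 \<Longrightarrow> e \<le> j u \<theta> / c \<theta>"
    using cond_U_density_lower_bound by blast
  define \<eta> where "\<eta> = uniform_measure lborel {0..1::real}"
  have \<eta>: "\<eta> \<in> space (prob_algebra borel)"
    unfolding \<eta>_def space_prob_algebra by (auto intro!: prob_space_uniform_measure)
  have \<nu>: "\<eta> \<bind> cond_Theta j \<in> space (prob_algebra borel)"
    using measurable_space[OF measurable_bind_prob_space[OF measurable_const[OF \<eta>] cond_Theta_measurable],
        of "0::real" borel] by simp
  have "ennreal e * emeasure (\<eta> \<bind> cond_Theta j) A \<le> emeasure (gibbs_kernel j \<theta>) A"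
    if \<theta>: "\<bar>T \<theta>\<bar> \<le> R" and A [measurable]: "A \<in> sets borel" for \<theta> A
  proof -
    let ?q = "\<lambda>u. emeasure (cond_Theta j u) A"
    have "emeasure (\<eta> \<bind> cond_Theta j) A = (\<integral>\<^sup>+u. ?q u * indicator {0..1} u \<partial>lborel)"
      using emeasure_bind_prob_algebra[OF \<eta> cond_Theta_measurable A]
      by (simp add: \<eta>_def nn_integral_uniform_measure divide_ennreal_def)
    then have "ennreal e * emeasure (\<eta> \<bind> cond_Theta j) A = (\<integral>\<^sup>+u. ennreal e * (?q u * indicator {0..1} u) \<partial>lborel)"
      by (simp add: nn_integral_cmult)
    also have "\<dots> \<le> (\<integral>\<^sup>+u. ennreal (j u \<theta> / c \<theta>) * ?q u \<partial>lborel)"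
      using e(2)[OF \<theta>]
      by (intro nn_integral_mono) (auto split: split_indicator intro!: mult_right_mono ennreal_leI)
    also have "\<dots> = emeasure (gibbs_kernel j \<theta>) A"
      by (simp add: emeasure_gibbs cond_U_eq nn_integral_density)
    finally show ?thesis .
  qed
  then show ?thesis using \<nu> e(1) by (auto simp: space_prob_algebra)
qed

section \<open>Drift of the hyperbolic cosine along the Gibbs kernel\<close>

definition noise :: "real measure" where "noise = density lborel (\<lambda>z. ennreal (h z))"

lemma sets_noise [simp, measurable_cong]: "sets noise = sets borel"
  by (simp add: noise_def)

lemma prob_space_noise: "prob_space noise"
  unfolding noise_def by (rule prob_spaceI) (simp add: emeasure_density nn_integral_h)

lemma noise_integral_odd:
  fixes f :: "real \<Rightarrow> real"
  assumes [measurable]: "f \<in> borel_measurable borel" and odd: "\<And>z. f (- z) = - f z"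
  shows "(\<integral>z. f z \<partial>noise) = 0"
proof -
  have "(\<integral>z. f z \<partial>noise) = (\<integral>z. h z * f z \<partial>lborel)"
    by (simp add: noise_def integral_density)
  also have "\<dots> = (\<integral>z. h (- z) * f (- z) \<partial>lborel)"
    using lborel_integral_real_affine[of "- 1" "\<lambda>z. h z * f z" 0] by simp
  also have "\<dots> = - (\<integral>z. h z * f z \<partial>lborel)"
    by (simp add: h_even odd)
  also have "(\<integral>z. h z * f z \<partial>lborel) = (\<integral>z. f z \<partial>noise)"
    by (simp add: noise_def integral_density)
  finally show ?thesis by simp
qed

text \<open>Substituting z = u - T \<theta>: given U = u, the variable T \<theta> is distributed as
  u - Z with Z of density \<open>h\<close>.\<close>

lemma nn_integral_cond_Theta:
  assumes [measurable]: "f \<in> borel_measurable borel"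
  shows "(\<integral>\<^sup>+\<theta>. f (T \<theta>) \<partial>cond_Theta j u) = (\<integral>\<^sup>+z. f (u - z) \<partial>noise)"
proof -
  have "(\<integral>\<^sup>+\<theta>. f (T \<theta>) \<partial>cond_Theta j u) = (\<integral>\<^sup>+\<theta>. ennreal (h (u - T \<theta>)) * f (u - (u - T \<theta>)) \<partial>lborel)"
    by (simp add: cond_Theta_eq nn_integral_density)
  also have "\<dots> = (\<integral>\<^sup>+z. ennreal (h z) * f (u - z) \<partial>lborel)"
    using nn_integral_T[of "\<lambda>z. ennreal (h z) * f (u - z)" u] by simp
  also have "\<dots> = (\<integral>\<^sup>+z. f (u - z) \<partial>noise)"
    by (simp add: noise_def nn_integral_density)
  finally show ?thesis .
qed

theorem geom_ergodic_if_drift: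
  assumes t: "0 < t" and tail: "\<And>\<theta>. (\<integral>\<^sup>+u. ennreal (exp (t * \<bar>u - T \<theta>\<bar>)) \<partial>cond_U j \<theta>) \<le> ennreal D"
    and t': "0 < t'" and mgf: "(\<integral>\<^sup>+z. ennreal (exp (t' * \<bar>z\<bar>)) \<partial>noise) \<le> ennreal D'"
    and d: "0 < d" and mean: "\<And>\<theta>. \<bar>T \<theta>\<bar> > k \<Longrightarrow> sgn (T \<theta>) * (\<integral>u. u - T \<theta> \<partial>cond_U j \<theta>) \<le> - d"
  shows "geom_ergodic j"
proof -
  have eU: "exp_moment (cond_U j \<theta>) (\<lambda>u. u - T \<theta>) t D" for \<theta>
    using tail t prob_space_cond_U by (intro exp_moment.intro exp_moment_axioms.intro) auto
  interpret Z: exp_moment noise "\<lambda>z. z" t' D'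
    using mgf t' prob_space_noise by (intro exp_moment.intro exp_moment_axioms.intro) auto
  define C where "C = 4 * D / t\<^sup>2"
  have C: "0 \<le> C" using exp_moment.C_nonneg[OF eU] by (simp add: C_def exp_moment.C_def[OF eU])
  obtain s where s: "0 < s" "s \<le> min (t / 2) (t' / 2)" "s * d \<le> 1"
      and lt1: "(1 + 2 * C * s\<^sup>2 - s * d) * (1 + Z.C * s\<^sup>2) < 1"
    using small_exponent_exists[of "2 * C" Z.C d "min (t / 2) (t' / 2)"] C Z.C_nonneg d t t' by auto
  have sU: "0 \<le> s" "s \<le> t / 2" and sZ: "0 \<le> s" "s \<le> t' / 2" using s by auto
  define H where "H = (\<integral>z. cosh (s * z) \<partial>noise)"
  define lam where "lam = (1 + 2 * C * s\<^sup>2 - s * d) * (1 + Z.C * s\<^sup>2)"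
  define L where "L = (s * d + cosh (s * k) * (1 + 2 * C * s\<^sup>2 + s * (D / t))) * (1 + Z.C * s\<^sup>2)"
  define V where "V = (\<lambda>\<theta>. cosh (s * T \<theta>))"
  have D1: "1 \<le> D" by (rule exp_moment.D_ge_1[OF eU])
  have H: "0 \<le> H" "H \<le> 1 + Z.C * s\<^sup>2"
    using Z.expectation_cosh_le[OF sZ] by (auto simp: H_def)
  have lam0: "0 \<le> lam"
  proof -
    have "0 \<le> 2 * C * s\<^sup>2" using C by simp
    then show ?thesis
      unfolding lam_def using s Z.C_nonneg by (intro mult_nonneg_nonneg add_nonneg_nonneg) auto
  qed
  have L: "0 < L"
    unfolding L_def using s C Z.C_nonneg d D1 t
    by (intro mult_pos_pos add_pos_nonneg mult_nonneg_nonneg) auto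
  have Vm [measurable]: "V \<in> borel_measurable borel"
    unfolding V_def T_def by (intro borel_measurable_continuous_onI continuous_intros)
  have cosh_m: "(\<lambda>p. ennreal (cosh (s * p))) \<in> borel_measurable borel"
    by (intro measurable_compose[OF _ measurable_ennreal] borel_measurable_continuous_onI continuous_intros)
  have inner: "(\<integral>\<^sup>+\<theta>. ennreal (V \<theta>) \<partial>cond_Theta j u) = ennreal (H * cosh (s * u))" for u
  proof -
    have e: "cosh (s * (u - z)) = cosh (s * u) * cosh (s * z) - sinh (s * u) * sinh (s * z)" for z
      by (simp add: right_diff_distrib cosh_diff)
    have i: "integrable noise (\<lambda>z. cosh (s * (u - z)))"
      unfolding e using Z.integrable_cosh[OF sZ] Z.integrable_sinh[OF sZ] by simp
    \<comment> \<open>Symmetry of the noise makes the half-step multiply cosh(s u) by exactly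
      \<open>H\<close>, with no sinh(s u) term.\<close>
    have "(\<integral>z. sinh (s * z) \<partial>noise) = 0"
      by (rule noise_integral_odd) (intro borel_measurable_continuous_onI continuous_intros, simp)
    then have "(\<integral>z. cosh (s * (u - z)) \<partial>noise) = H * cosh (s * u)"
      unfolding e using Z.integrable_cosh[OF sZ] Z.integrable_sinh[OF sZ] by (simp add: H_def)
    then show ?thesis
      unfolding V_def using nn_integral_cond_Theta[OF cosh_m, of u]
      by (simp add: nn_integral_eq_integral[OF i])
  qed
  have drift: "(\<integral>\<^sup>+z. ennreal (V z) \<partial>gibbs_kernel j \<theta>) \<le> ennreal (lam * V \<theta> + L)" for \<theta>
  proof -
    interpret U: exp_moment "cond_U j \<theta>" "\<lambda>u. u - T \<theta>" t D by (rule eU)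
    have iU: "integrable (cond_U j \<theta>) (\<lambda>u. cosh (s * u))"
      using U.integrable_cosh_add[OF sU, of "T \<theta>"] by simp
    have le: "(\<integral>u. cosh (s * u) \<partial>cond_U j \<theta>) \<le>
        (1 + 2 * C * s\<^sup>2 - s * d) * V \<theta> + (s * d + cosh (s * k) * (1 + 2 * C * s\<^sup>2 + s * (D / t)))"
      \<comment> \<open>Applied at p = T \<theta> with increment u - T \<theta>, so that p plus the
        increment is u.\<close>
      using U.expectation_cosh_drift[OF sU d s(3) mean]
      by (simp add: U.C_def C_def V_def)
    have "(\<integral>\<^sup>+z. ennreal (V z) \<partial>gibbs_kernel j \<theta>) = (\<integral>\<^sup>+u. ennreal (H * cosh (s * u)) \<partial>cond_U j \<theta>)"
      unfolding gibbs_kernel_def inner[symmetric]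
      by (rule nn_integral_bind[OF measurable_compose[OF Vm measurable_ennreal] cond_Theta_measurable_cond_U])
    also have "\<dots> = ennreal (H * (\<integral>u. cosh (s * u) \<partial>cond_U j \<theta>))"
      using iU H by (subst nn_integral_eq_integral) auto
    also have "\<dots> \<le> ennreal ((1 + Z.C * s\<^sup>2) * ((1 + 2 * C * s\<^sup>2 - s * d) * V \<theta>
        + (s * d + cosh (s * k) * (1 + 2 * C * s\<^sup>2 + s * (D / t)))))"
      using le H by (intro ennreal_leI mult_mono) auto
    also have "\<dots> = ennreal (lam * V \<theta> + L)"
      unfolding lam_def L_def by (simp add: algebra_simps)
    finally show ?thesis .
  qed
  \<comment> \<open>From s|T \<theta>| <= exp(s|T \<theta>|) <= 2 cosh(s T \<theta>): the sublevel
    set of \<open>V\<close> lies in |T \<theta>| <= R.\<close>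
  define R where "R = 2 * (4 * L / (1 - lam)) / s"
  obtain e \<nu> where \<nu>: "prob_space \<nu>" "sets \<nu> = sets borel" "0 < e"
      "\<And>\<theta> A. \<bar>T \<theta>\<bar> \<le> R \<Longrightarrow> A \<in> sets borel \<Longrightarrow> ennreal e * emeasure \<nu> A \<le> emeasure (gibbs_kernel j \<theta>) A"
    using minorization[of R] by blast
  have V_bound: "\<bar>T \<theta>\<bar> \<le> R" if "V \<theta> \<le> 4 * L / (1 - lam)" for \<theta>
  proof -
    have "s * \<bar>T \<theta>\<bar> \<le> exp (s * \<bar>T \<theta>\<bar>)" using exp_ge_add_one_self[of "s * \<bar>T \<theta>\<bar>"] by linarith
    also have "\<dots> \<le> 2 * cosh (s * \<bar>T \<theta>\<bar>)" by (simp add: cosh_field_def)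
    also have "cosh (s * \<bar>T \<theta>\<bar>) = V \<theta>"
      using cosh_real_abs[of "s * T \<theta>"] s by (simp add: V_def abs_mult)
    finally have "\<bar>T \<theta>\<bar> * s \<le> 2 * (4 * L / (1 - lam))" using that by (simp only: mult.commute)
    then show ?thesis unfolding R_def using s(1) by (simp only: pos_le_divide_eq)
  qed
  interpret harris_kernel borel "gibbs_kernel j" V lam L \<nu> e
  proof (intro harris_kernel.intro drift_kernel.intro harris_kernel_axioms.intro)
    show "0 \<le> V \<theta>" for \<theta> by (simp add: V_def)
    show "lam < 1" using lt1 by (simp only: lam_def)
    show "ennreal e * emeasure \<nu> A \<le> emeasure (gibbs_kernel j \<theta>) A"
      if "V \<theta> \<le> 4 * L / (1 - lam)" "A \<in> sets borel" for \<theta> A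
      using \<nu>(4) V_bound that by blast
  qed (fact gibbs_measurable Vm lam0 L \<nu> | rule drift)+
  show ?thesis
    unfolding geom_ergodic_def
  proof (intro exI conjI allI)
    show "0 \<le> rate" "rate < 1" by (rule rate_nonneg, rule rate_less_1)
    fix \<theta>0 n
    show "tv_dist (theta_chain j \<theta>0 n) (post_theta j) \<le> (2 + beta * (V \<theta>0 + L / (1 - lam))) * rate ^ n"
      unfolding tv_dist_def theta_chain_def
      by (intro cSUP_least geometric_ergodicity[OF prob_space_post sets_post post_invariant]) auto
  qed
qed

end

section \<open>The centred and non-centred parametrisations\<close>

lemma ndens_shift:
  fixes q :: "real \<Rightarrow> real"
  assumes [measurable]: "q \<in> borel_measurable borel"
  shows "ndens (\<lambda>x. q (x - a)) = distr (ndens q) borel (\<lambda>u. u + a)"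
proof (rule measure_eqI)
  let ?I = "\<integral>s. q s \<partial>lborel"
  have I: "(\<integral>s. q (s - a) \<partial>lborel) = ?I"
    using lborel_integral_real_affine[of 1 q "- a"] by simp
  show "sets (ndens (\<lambda>x. q (x - a))) = sets (distr (ndens q) borel (\<lambda>u. u + a))"
    by (simp add: ndens_def)
  fix A assume "A \<in> sets (ndens (\<lambda>x. q (x - a)))"
  then have A [measurable]: "A \<in> sets borel" by (simp add: ndens_def)
  have "emeasure (ndens (\<lambda>x. q (x - a))) A = (\<integral>\<^sup>+x. ennreal (q (x - a) / ?I) * indicator A x \<partial>lborel)"
    by (simp add: ndens_def I emeasure_density)
  also have "\<dots> = (\<integral>\<^sup>+u. ennreal (q u / ?I) * indicator A (a + u) \<partial>lborel)"
    using nn_integral_real_affine[of "\<lambda>x. ennreal (q (x - a) / ?I) * indicator A x" 1 a] by simp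
  also have "\<dots> = (\<integral>\<^sup>+u. ennreal (q u / ?I) * indicator ((\<lambda>u. u + a) -` A) u \<partial>lborel)"
    by (intro nn_integral_cong) (simp add: indicator_def add.commute)
  also have "\<dots> = emeasure (distr (ndens q) borel (\<lambda>u. u + a)) A"
    by (subst emeasure_distr) (auto simp: ndens_def emeasure_density measurable_sets_borel[of _ borel])
  finally show "emeasure (ndens (\<lambda>x. q (x - a))) A = emeasure (distr (ndens q) borel (\<lambda>u. u + a)) A" .
qed

text \<open>Given \<theta>, X is the non-centred variable shifted by \<theta>. This transfers GTIP
  of one parametrisation to the conditional laws of the other.\<close>

lemma cond_U_joint0_eq_distr:
  assumes "f1 \<in> borel_measurable borel" "f2 \<in> borel_measurable borel"
  shows "cond_U (joint0 y f1 f2) \<theta> = distr (cond_U (joint1 y f1 f2) \<theta>) borel (\<lambda>u. u + \<theta>)"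
proof -
  have "cond_U (joint0 y f1 f2) \<theta> = ndens (\<lambda>x. joint1 y f1 f2 (x - \<theta>) \<theta>)"
    by (simp add: cond_U_def joint0_def joint1_def)
  also have "\<dots> = distr (cond_U (joint1 y f1 f2) \<theta>) borel (\<lambda>u. u + \<theta>)"
    unfolding cond_U_def by (rule ndens_shift) (use assms in \<open>simp add: joint1_def\<close>)
  finally show ?thesis .
qed

text \<open>exp(t|z|) <= exp(t z) + exp(-t z), with t half the radius so that both signs stay
  strictly inside it.\<close>

lemma mgf_finite_exp_abs:
  assumes "mgf_finite_near0 f" and [measurable]: "f \<in> borel_measurable borel" and nonneg: "\<And>z. 0 \<le> f z"
  shows "\<exists>t D. 0 < t \<and> (\<integral>\<^sup>+z. ennreal (exp (t * \<bar>z\<bar>)) \<partial>density lborel (\<lambda>z. ennreal (f z))) \<le> ennreal D"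
proof -
  obtain \<delta> where \<delta>: "0 < \<delta>" "\<And>t. \<bar>t\<bar> < \<delta> \<Longrightarrow> integrable lborel (\<lambda>z. exp (t * z) * f z)"
    using assms(1) by (auto simp: mgf_finite_near0_def)
  define t where "t = \<delta> / 2"
  have t: "0 < t" "\<bar>t\<bar> < \<delta>" "\<bar>- t\<bar> < \<delta>" using \<delta>(1) by (auto simp: t_def)
  let ?g = "\<lambda>z. exp (t * z) * f z + exp (- t * z) * f z"
  have i: "integrable lborel ?g"
    by (intro Bochner_Integration.integrable_add \<delta>(2) t)
  have "(\<integral>\<^sup>+z. ennreal (exp (t * \<bar>z\<bar>)) \<partial>density lborel (\<lambda>z. ennreal (f z)))
      = (\<integral>\<^sup>+z. ennreal (f z) * ennreal (exp (t * \<bar>z\<bar>)) \<partial>lborel)"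
    by (rule nn_integral_density) auto
  also have "\<dots> \<le> (\<integral>\<^sup>+z. ennreal (?g z) \<partial>lborel)"
  proof (rule nn_integral_mono)
    fix z :: real
    have "exp (t * \<bar>z\<bar>) \<le> exp (t * z) + exp (- t * z)" by (cases "0 \<le> z") auto
    then have "f z * exp (t * \<bar>z\<bar>) \<le> ?g z"
      using mult_left_mono[OF _ nonneg[of z]] by (fastforce simp: algebra_simps)
    moreover have "ennreal (f z) * ennreal (exp (t * \<bar>z\<bar>)) = ennreal (f z * exp (t * \<bar>z\<bar>))"
      using nonneg[of z] by (simp add: ennreal_mult)
    ultimately show "ennreal (f z) * ennreal (exp (t * \<bar>z\<bar>)) \<le> ennreal (?g z)"
      by (simp only: ennreal_leI)
  qed
  also have "\<dots> = ennreal (\<integral>z. ?g z \<partial>lborel)"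
    using i nonneg by (intro nn_integral_eq_integral) auto
  finally show ?thesis using t(1) by blast
qed

lemma GTIP_exp_moment:
  assumes "GTIP j" and prob: "\<And>\<theta>. prob_space (cond_U j \<theta>)"
  shows "\<exists>t D. 0 < t \<and> (\<forall>\<theta>. (\<integral>\<^sup>+u. ennreal (exp (t * \<bar>u\<bar>)) \<partial>cond_U j \<theta>) \<le> ennreal D)"
proof -
  obtain a b where ab: "0 < b"
      "\<And>\<theta> x. 0 \<le> x \<Longrightarrow> measure (cond_U j \<theta>) {u. \<bar>u\<bar> > x} \<le> a * exp (- b * x)"
    using assms(1) unfolding GTIP_def by blast
  have "(\<integral>\<^sup>+u. ennreal (exp (b / 2 * \<bar>u\<bar>)) \<partial>cond_U j \<theta>) \<le> ennreal (1 + a * exp (b / 2) / (1 - exp (- b / 2)))" for \<theta>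
    using prob[of \<theta>] ab by (intro exp_moment_of_tail) (auto simp: cond_U_def ndens_def)
  then show ?thesis using ab(1) by (intro exI[of _ "b / 2"] exI conjI allI) auto
qed

theorem mainTheorem3:
  fixes y :: real and f1 f2 :: "real \<Rightarrow> real"
  assumes f1: "noise_density f1" and f2: "noise_density f2"
    and proper: "(\<integral>\<^sup>+\<theta>. (\<integral>\<^sup>+x. ennreal (joint0 y f1 f2 x \<theta>) \<partial>lborel) \<partial>lborel) < \<infinity>"
  shows "(DUR y f1 f2 \<and> GTIP (joint1 y f1 f2) \<and> mgf_finite_near0 f2
            \<longrightarrow> geom_ergodic (joint0 y f1 f2))
       \<and> (PUR y f1 f2 \<and> GTIP (joint0 y f1 f2) \<and> mgf_finite_near0 f1
            \<longrightarrow> geom_ergodic (joint1 y f1 f2))"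
proof -
  let ?j0 = "joint0 y f1 f2" and ?j1 = "joint1 y f1 f2"
  have m [measurable]: "f1 \<in> borel_measurable borel" "f2 \<in> borel_measurable borel"
    using f1 f2 by (auto simp: noise_density_def intro: borel_measurable_continuous_onI)
  interpret C: two_block_gibbs "\<lambda>x. f1 (y - x)" f2 1 0 ?j0
  proof
    show "continuous_on UNIV (\<lambda>x. f1 (y - x))"
      using f1 by (intro continuous_on_compose2[of UNIV f1 UNIV "\<lambda>x. y - x"] continuous_on_diff
          continuous_on_const continuous_on_id) (auto simp: noise_density_def)
    show "bounded (range (\<lambda>x. f1 (y - x)))"
      using f1 by (auto simp: noise_density_def intro: bounded_subset)
    show "integrable lborel (\<lambda>x. f1 (y - x))"
      using f1 lborel_integrable_real_affine[of f1 "- 1" y] by (simp add: noise_density_def)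
    show "(\<integral>x. f1 (y - x) \<partial>lborel) = 1"
      using f1 lborel_integral_real_affine[of "- 1" f1 y] by (simp add: noise_density_def)
  qed (use f1 f2 in \<open>auto simp: noise_density_def joint0_def\<close>)
  interpret NC: two_block_gibbs f2 f1 "- 1" y ?j1
  proof
    \<comment> \<open>Evenness of \<open>f1\<close>: the two arguments are negatives of each
      other.\<close>
    have "f1 (y - (u + \<theta>)) = f1 (u - (- 1 * \<theta> + y))" for u \<theta>
      using f1 unfolding noise_density_def by (metis (no_types) minus_diff_eq mult_minus1 add.commute diff_minus_eq_add diff_diff_eq2)
    then show "?j1 u \<theta> = f2 u * f1 (u - (- 1 * \<theta> + y))" for u \<theta>
      by (simp add: joint1_def)
  qed (use f1 f2 in \<open>auto simp: noise_density_def\<close>)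
  note distr = cond_U_joint0_eq_distr[OF m, of y]
  have shift [measurable]: "(\<lambda>u. u + \<theta>) \<in> cond_U ?j1 \<theta> \<rightarrow>\<^sub>M borel" for \<theta>
    by simp
  have "geom_ergodic ?j0" if DUR: "DUR y f1 f2" and GTIP: "GTIP ?j1" and mgf: "mgf_finite_near0 f2"
  proof -
    obtain t D where t: "0 < t" and D: "\<And>\<theta>. (\<integral>\<^sup>+u. ennreal (exp (t * \<bar>u\<bar>)) \<partial>cond_U ?j1 \<theta>) \<le> ennreal D"
      using GTIP_exp_moment[OF GTIP NC.prob_space_cond_U] by blast
    obtain t' D' where t': "0 < t'" "(\<integral>\<^sup>+z. ennreal (exp (t' * \<bar>z\<bar>)) \<partial>C.noise) \<le> ennreal D'"
      using mgf_finite_exp_abs[OF mgf m(2)] by (auto simp: C.noise_def)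
    obtain d k where d: "0 < d" and DUR': "\<And>\<theta>. \<bar>\<theta>\<bar> > k \<Longrightarrow> integrable (cond_U ?j0 \<theta>) (\<lambda>x. x)"
        "\<And>\<theta>. \<bar>\<theta>\<bar> > k \<Longrightarrow> \<bar>\<integral>x. x \<partial>cond_U ?j0 \<theta>\<bar> \<le> \<bar>\<theta>\<bar> - d"
      using DUR unfolding DUR_def by blast
    show ?thesis
    proof (rule C.geom_ergodic_if_drift[OF t _ t' d])
      show "(\<integral>\<^sup>+x. ennreal (exp (t * \<bar>x - C.T \<theta>\<bar>)) \<partial>cond_U ?j0 \<theta>) \<le> ennreal D" for \<theta>
        using D[of \<theta>] by (simp add: distr nn_integral_distr C.T_def)
      fix \<theta> assume "\<bar>C.T \<theta>\<bar> > k"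
      then have k: "\<bar>\<theta>\<bar> > k" by (simp add: C.T_def)
      interpret prob_space "cond_U ?j0 \<theta>" by (rule C.prob_space_cond_U)
      have "(\<integral>x. x - C.T \<theta> \<partial>cond_U ?j0 \<theta>) = (\<integral>x. x \<partial>cond_U ?j0 \<theta>) - \<theta>"
        using DUR'(1)[OF k] by (simp add: C.T_def prob_space[simplified])
      \<comment> \<open>DUR bounds the mean of X on both sides; only the side facing \<theta> is
        used: sgn(\<theta>) E X <= |E X| <= |\<theta>| - d.\<close>
      then show "sgn (C.T \<theta>) * (\<integral>x. x - C.T \<theta> \<partial>cond_U ?j0 \<theta>) \<le> - d"
        using DUR'(2)[OF k] d by (cases \<theta> "0::real" rule: linorder_cases) (auto simp: C.T_def)
    qed
  qed
  moreover have "geom_ergodic ?j1" if PUR: "PUR y f1 f2" and GTIP: "GTIP ?j0" and mgf: "mgf_finite_near0 f1"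
  proof -
    obtain t D where t: "0 < t" and D: "\<And>\<theta>. (\<integral>\<^sup>+x. ennreal (exp (t * \<bar>x\<bar>)) \<partial>cond_U ?j0 \<theta>) \<le> ennreal D"
      using GTIP_exp_moment[OF GTIP C.prob_space_cond_U] by blast
    obtain t' D' where t': "0 < t'" "(\<integral>\<^sup>+z. ennreal (exp (t' * \<bar>z\<bar>)) \<partial>NC.noise) \<le> ennreal D'"
      using mgf_finite_exp_abs[OF mgf m(1)] by (auto simp: NC.noise_def)
    obtain d k where d: "0 < d" and k: "0 < k" and
        PUR': "\<And>\<theta>. \<bar>\<theta>\<bar> > k \<Longrightarrow> sgn \<theta> * (\<integral>x. x - y \<partial>cond_U ?j0 \<theta>) \<ge> d"
      using PUR unfolding PUR_def by blast
    show ?thesis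
    proof (rule NC.geom_ergodic_if_drift[OF t _ t' d])
      fix \<theta>
      \<comment> \<open>The deviation is X - y, whereas GTIP controls X; the shift by
        \<open>y\<close> costs the factor exp(t|y|).\<close>
      have "(\<integral>\<^sup>+u. ennreal (exp (t * \<bar>u - NC.T \<theta>\<bar>)) \<partial>cond_U ?j1 \<theta>)
          = (\<integral>\<^sup>+x. ennreal (exp (t * \<bar>x - y\<bar>)) \<partial>cond_U ?j0 \<theta>)"
        by (simp add: distr nn_integral_distr NC.T_def algebra_simps)
      also have "\<dots> \<le> (\<integral>\<^sup>+x. ennreal (exp (t * \<bar>y\<bar>)) * ennreal (exp (t * \<bar>x\<bar>)) \<partial>cond_U ?j0 \<theta>)"
      proof (rule nn_integral_mono)
        fix x
        have "t * \<bar>x - y\<bar> \<le> t * (\<bar>y\<bar> + \<bar>x\<bar>)" using t by (intro mult_left_mono) auto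
        then show "ennreal (exp (t * \<bar>x - y\<bar>)) \<le> ennreal (exp (t * \<bar>y\<bar>)) * ennreal (exp (t * \<bar>x\<bar>))"
          by (simp add: ennreal_mult[symmetric] exp_add[symmetric] distrib_left ennreal_leI)
      qed
      also have "\<dots> = ennreal (exp (t * \<bar>y\<bar>)) * (\<integral>\<^sup>+x. ennreal (exp (t * \<bar>x\<bar>)) \<partial>cond_U ?j0 \<theta>)"
        by (rule nn_integral_cmult) simp
      also have "\<dots> \<le> ennreal (exp (t * \<bar>y\<bar>)) * ennreal D"
        using D by (intro mult_left_mono) auto
      also have "\<dots> = ennreal (exp (t * \<bar>y\<bar>) * D)" by (simp add: ennreal_mult')
      finally show "(\<integral>\<^sup>+u. ennreal (exp (t * \<bar>u - NC.T \<theta>\<bar>)) \<partial>cond_U ?j1 \<theta>) \<le> ennreal (exp (t * \<bar>y\<bar>) * D)" .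
    next
      \<comment> \<open>The margin |y| ensures that |\<theta>| > k and that y - \<theta> has the
        sign of -\<theta>; this flip turns the outward push of PUR in \<theta> into an inward push
        for \<open>T \<theta>\<close>.\<close>
      fix \<theta> assume "\<bar>NC.T \<theta>\<bar> > k + \<bar>y\<bar>"
      then have \<theta>: "\<bar>\<theta>\<bar> > k" and s: "sgn (NC.T \<theta>) = - sgn \<theta>"
        using k by (auto simp: NC.T_def sgn_real_def)
      have "(\<integral>u. u - NC.T \<theta> \<partial>cond_U ?j1 \<theta>) = (\<integral>x. x - y \<partial>cond_U ?j0 \<theta>)"
        by (simp add: distr integral_distr NC.T_def algebra_simps)
      then show "sgn (NC.T \<theta>) * (\<integral>u. u - NC.T \<theta> \<partial>cond_U ?j1 \<theta>) \<le> - d"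
        using PUR'[OF \<theta>] s by simp
    qed
  qed
  ultimately show ?thesis by blast
qed

end
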